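(* Let $W$ be a $1|2$-dimensional $\mathbb{Z}_2$-graded vector space over $\mathfrak K$, and let $m\ge 0$ be an integer. Every nonzero codifferential lying in $L_{m+2}$ is equivalent to exactly one of the following codifferentials: $$d_\infty=\psi^{1,1,m}_1,$$ $$d_\lambda=\psi^{0,1,m+1}_3+\psi^{1,1,m}_1\lambda\quad(\lambda\in\mathfrak K),$$ $$d_*=\psi^{0,0,m+2}_1,$$ $$d_{\#}=\psi^{0,1,m+1}_3+\psi^{0,0,m+2}_1-\psi^{1,1,m}_1(m+2).$$ In particular, none of these four types is equivalent to any of the others, and $d_\lambda$ is equivalent to $d_\mu$ if and only if $\lambda=\mu$.
   Context: $\mathfrak K$ is an algebraically closed field of characteristic zero. $W=\langle w_1,w_2,w_3\rangle$ is the $\mathbb{Z}_2$-graded vector space with $w_1,w_2$ odd and $w_3$ even. $S(W)=\bigoplus_{n\ge1}S^n(W)$ is the reduced $\mathbb{Z}_2$-graded symmetric algebra (with $uv=(-1)^{uv}vu$), with its coalgebra structure $\Delta(v_1\cdots v_n)=\sum_{k=1}^{n-1}\sum_{\sigma\in \mathrm{Sh}(k,n-k)}\epsilon(\sigma)\,v_{\sigma(1)}\cdots v_{\sigma(k)}\otimes v_{\sigma(k+1)}\cdots v_{\sigma(n)}$, where $\mathrm{Sh}(k,n-k)$ is the set of unshuffles and $\epsilon(\sigma)$ is the sign with $v_{\sigma(1)}\cdots v_{\sigma(n)}=\epsilon(\sigma)v_1\cdots v_n$. Put $L_n=\mathrm{Hom}(S^n(W),W)$ and $L=\mathrm{Hom}(S(W),W)=\prod_{n\ge1}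 L_n$. Each $\varphi\in L_k$ extends to a coderivation $\tilde\varphi$ of $S(W)$ by $\tilde\varphi(v_1\cdots v_n)=\sum_{\sigma\in\mathrm{Sh}(k,n-k)}\epsilon(\sigma)\varphi(v_{\sigma(1)}\cdots v_{\sigma(k)})v_{\sigma(k+1)}\cdots v_{\sigma(n)}$, and this identifies $L$ with the coderivations of $S(W)$. The bracket on $L$ is $[\alpha,\beta]=\alpha\tilde\beta-(-1)^{\alpha\beta}\beta\tilde\alpha$. A codifferential (an $L_\infty$ structure on $W$, in the parity-reversed convention) is an odd element $d\in L$ with $[d,d]=0$, equivalently $\tilde d^2=0$. Two codifferentials $d,d'$ are equivalent if there is a parity-preserving coalgebra automorphism $\tilde g$ of $S(W)$ (determined by $g=g_1+g_2+\cdots\in L$, $g_i:S^i(W)\to W$ even, $g_1$ invertible) with $d'=\tilde g^{-1}\circ d\circ\tilde g$. For $I=(i_1,i_2,i_3)$ with $i_1,i_2\in\{0,1\}$, $i_3\ge0$ and $|I|=i_1+i_2+i_3\ge1$, let $w_I=w_1^{i_1}w_2^{i_2}w_3^{i_3}$ and $I!=i_1!i_2!i_3!$. The element $\varphi^I_j\in L_{|I|}$ is defined by $\varphi^I_j(w_J)=I!\,\delta^I_J\,w_j$. It is written $\psi^I_j$ when it is odd. *)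

theory Defs
  imports
    "HOL-Computational_Algebra.Polynomial"
    "HOL-Library.Poly_Mapping"
    "HOL-Combinatorics.Permutations"
begin

section \<open>Vector spaces with a distinguished basis\<close>

text \<open>The space with basis \<open>'a\<close> over \<open>'k\<close> is \<open>'a \<Rightarrow>\<^sub>0 'k\<close>; the basis vector of \<open>x\<close> is
  \<open>Poly_Mapping.single x 1\<close>.\<close>

definition scal :: "'k::field \<Rightarrow> ('a \<Rightarrow>\<^sub>0 'k) \<Rightarrow> ('a \<Rightarrow>\<^sub>0 'k)" (infixr "\<cdot>" 75)
  where "c \<cdot> v = Poly_Mapping.map ((*) c) v"

lemma lookup_scal [simp]: "Poly_Mapping.lookup (c \<cdot> v) x = c * Poly_Mapping.lookup v x"
  by (auto simp: scal_def Poly_Mapping.map.rep_eq when_def)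

interpretation scal: vector_space "scal :: 'k::field \<Rightarrow> ('a \<Rightarrow>\<^sub>0 'k) \<Rightarrow> ('a \<Rightarrow>\<^sub>0 'k)"
  by unfold_locales (auto intro!: poly_mapping_eqI simp: Poly_Mapping.lookup_add algebra_simps)

abbreviation lin_map :: "(('a \<Rightarrow>\<^sub>0 'k::field) \<Rightarrow> ('b \<Rightarrow>\<^sub>0 'k)) \<Rightarrow> bool"
  where "lin_map f \<equiv> Vector_Spaces.linear scal scal f"

text \<open>Linear extension of a map given on the basis.\<close>

definition lin_ext :: "('a \<Rightarrow> ('b \<Rightarrow>\<^sub>0 'k)) \<Rightarrow> ('a \<Rightarrow>\<^sub>0 'k::field) \<Rightarrow> ('b \<Rightarrow>\<^sub>0 'k)"
  where "lin_ext f v = (\<Sum>x\<in>Poly_Mapping.keys v. Poly_Mapping.lookup v x \<cdot> f x)"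

definition tensor :: "('a \<Rightarrow>\<^sub>0 'k::field) \<Rightarrow> ('b \<Rightarrow>\<^sub>0 'k) \<Rightarrow> ('a \<times> 'b \<Rightarrow>\<^sub>0 'k)"
  where "tensor u v = (\<Sum>x\<in>Poly_Mapping.keys u. \<Sum>y\<in>Poly_Mapping.keys v.
    Poly_Mapping.single (x, y) (Poly_Mapping.lookup u x * Poly_Mapping.lookup v y))"

text \<open>\<open>f \<otimes> g\<close> for even \<open>f\<close> and \<open>g\<close> (so that no Koszul sign occurs).\<close>

definition tensor_map ::
    "(('a \<Rightarrow>\<^sub>0 'k::field) \<Rightarrow> ('c \<Rightarrow>\<^sub>0 'k)) \<Rightarrow> (('b \<Rightarrow>\<^sub>0 'k) \<Rightarrow> ('d \<Rightarrow>\<^sub>0 'k))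
      \<Rightarrow> ('a \<times> 'b \<Rightarrow>\<^sub>0 'k) \<Rightarrow> ('c \<times> 'd \<Rightarrow>\<^sub>0 'k)"
  where "tensor_map f g =
    lin_ext (\<lambda>(x, y). tensor (f (Poly_Mapping.single x 1)) (g (Poly_Mapping.single y 1)))"

text \<open>Parities are natural numbers read modulo 2.\<close>

definition homogeneous :: "('a \<Rightarrow> nat) \<Rightarrow> nat \<Rightarrow> ('a \<Rightarrow>\<^sub>0 'k::zero) \<Rightarrow> bool"
  where "homogeneous par p v \<longleftrightarrow> (\<forall>x\<in>Poly_Mapping.keys v. par x mod 2 = p mod 2)"

definition map_of_parity ::
    "('a \<Rightarrow> nat) \<Rightarrow> ('b \<Rightarrow> nat) \<Rightarrow> nat \<Rightarrow> (('a \<Rightarrow>\<^sub>0 'k::zero) \<Rightarrow> ('b \<Rightarrow>\<^sub>0 'k)) \<Rightarrow> bool"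
  where "map_of_parity par par' q f \<longleftrightarrow>
    (\<forall>p v. homogeneous par p v \<longrightarrow> homogeneous par' (p + q) (f v))"


section \<open>The space \<open>W\<close> and its reduced graded symmetric algebra\<close>

datatype gen = W1 | W2 | W3

type_synonym 'k W = "gen \<Rightarrow>\<^sub>0 'k"

fun gpar :: "gen \<Rightarrow> nat"
  where "gpar W1 = 1" | "gpar W2 = 1" | "gpar W3 = 0"

text \<open>The index \<open>(i1, i2, i3)\<close> stands for the basis monomial \<open>w\<^sub>1^i1 w\<^sub>2^i2 w\<^sub>3^i3\<close>.\<close>

typedef mon = "{(i1, i2, i3). i1 \<le> 1 \<and> i2 \<le> 1 \<and> 1 \<le> i1 + i2 + (i3 :: nat)}"
  by (rule exI[of _ "(0, 0, 1)"]) simp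

type_synonym 'k S = "mon \<Rightarrow>\<^sub>0 'k"

definition mdeg :: "mon \<Rightarrow> nat"
  where "mdeg I = (case Rep_mon I of (i1, i2, i3) \<Rightarrow> i1 + i2 + i3)"

definition mpar :: "mon \<Rightarrow> nat"
  where "mpar I = (case Rep_mon I of (i1, i2, i3) \<Rightarrow> i1 * gpar W1 + i2 * gpar W2 + i3 * gpar W3)"

definition word :: "mon \<Rightarrow> gen list"
  where "word I = (case Rep_mon I of (i1, i2, i3) \<Rightarrow>
    replicate i1 W1 @ replicate i2 W2 @ replicate i3 W3)"

text \<open>The product \<open>v\<^sub>1 \<cdots> v\<^sub>n\<close> in \<open>S(W)\<close> of a nonempty word in the basis of \<open>W\<close>, with
  \<open>uv = (-1)^(uv) vu\<close>: sorting the word produces one sign for each \<open>w\<^sub>2\<close> standing before a \<open>w\<^sub>1\<close>,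
  and a repeated odd generator gives zero. (\<open>S(W)\<close> has no unit; the value on \<open>[]\<close> is never used.)\<close>

definition wprod :: "gen list \<Rightarrow> 'k::field S"
  where "wprod ws =
    (if ws = [] \<or> count_list ws W1 > 1 \<or> count_list ws W2 > 1 then 0
     else Poly_Mapping.single
       (Abs_mon (count_list ws W1, count_list ws W2, count_list ws W3))
       ((-1) ^ card {(i, j). i < j \<and> j < length ws \<and> ws ! i = W2 \<and> ws ! j = W1}))"

text \<open>The product \<open>x v\<^sub>1 \<cdots> v\<^sub>n\<close> of \<open>x \<in> W\<close> with a possibly empty word.\<close>

definition lmult :: "'k::field W \<Rightarrow> gen list \<Rightarrow> 'k S"
  where "lmult x ws = lin_ext (\<lambda>v. wprod (v # ws)) x"


section \<open>The coalgebra \<open>S(W)\<close>\<close>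

text \<open>Positions are numbered from \<open>0\<close>.\<close>

definition unshuffles :: "nat \<Rightarrow> nat \<Rightarrow> (nat \<Rightarrow> nat) set"
  where "unshuffles k l = {\<sigma>. \<sigma> permutes {..<k + l} \<and>
    strict_mono_on {..<k} \<sigma> \<and> strict_mono_on {k..<k + l} \<sigma>}"

text \<open>The sign \<open>\<epsilon>(\<sigma>)\<close> with \<open>v\<^bsub>\<sigma>(1)\<^esub> \<cdots> v\<^bsub>\<sigma>(n)\<^esub> = \<epsilon>(\<sigma>) v\<^sub>1 \<cdots> v\<^sub>n\<close>: one factor \<open>-1\<close> for each inversion
  of \<open>\<sigma>\<close> between two odd letters.\<close>

definition koszul :: "(nat \<Rightarrow> nat) \<Rightarrow> gen list \<Rightarrow> 'k::field"
  where "koszul \<sigma> ws = (-1) ^ card {(i, j). i < j \<and> j < length ws \<and> \<sigma> j < \<sigma> i \<and>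
    odd (gpar (ws ! \<sigma> i)) \<and> odd (gpar (ws ! \<sigma> j))}"

definition front :: "(nat \<Rightarrow> nat) \<Rightarrow> nat \<Rightarrow> gen list \<Rightarrow> gen list"
  where "front \<sigma> k ws = map (\<lambda>i. ws ! \<sigma> i) [0..<k]"

definition rear :: "(nat \<Rightarrow> nat) \<Rightarrow> nat \<Rightarrow> gen list \<Rightarrow> gen list"
  where "rear \<sigma> k ws = map (\<lambda>i. ws ! \<sigma> i) [k..<length ws]"

definition coprod_word :: "gen list \<Rightarrow> (mon \<times> mon \<Rightarrow>\<^sub>0 'k::field)"
  where "coprod_word ws = (\<Sum>k\<in>{1..<length ws}. \<Sum>\<sigma>\<in>unshuffles k (length ws - k).
    koszul \<sigma> ws \<cdot> tensor (wprod (front \<sigma> k ws)) (wprod (rear \<sigma> k ws)))"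

definition coprod :: "'k::field S \<Rightarrow> (mon \<times> mon \<Rightarrow>\<^sub>0 'k)"
  where "coprod = lin_ext (\<lambda>I. coprod_word (word I))"

definition coalg_automorphism :: "('k::field S \<Rightarrow> 'k S) \<Rightarrow> bool"
  where "coalg_automorphism G \<longleftrightarrow> lin_map G \<and> bij G \<and> map_of_parity mpar mpar 0 G \<and>
    coprod \<circ> G = tensor_map G G \<circ> coprod"


section \<open>The graded Lie algebra \<open>L = Hom(S(W), W)\<close>\<close>

text \<open>\<open>L\<^sub>n = Hom(S\<^sup>n(W), W)\<close>, as the maps on \<open>S(W)\<close> vanishing on all \<open>S\<^sup>k(W)\<close> with \<open>k \<noteq> n\<close>.\<close>

definition L :: "nat \<Rightarrow> ('k::field S \<Rightarrow> 'k W) set"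
  where "L n = {\<phi>. lin_map \<phi> \<and> (\<forall>p. (\<forall>I\<in>Poly_Mapping.keys p. mdeg I \<noteq> n) \<longrightarrow> \<phi> p = 0)}"

text \<open>The coderivation \<open>\<phi>~\<close> for \<open>\<phi> = \<phi>\<^sub>1 + \<phi>\<^sub>2 + \<dots>\<close> with \<open>\<phi>\<^sub>k \<in> L\<^sub>k\<close>. The \<open>k\<close>-th summand is the
  extension of \<open>\<phi>\<^sub>k\<close>, since \<open>\<phi>\<close> is applied there to a product of \<open>k\<close> letters.\<close>

definition coder_word :: "('k::field S \<Rightarrow> 'k W) \<Rightarrow> gen list \<Rightarrow> 'k S"
  where "coder_word \<phi> ws = (\<Sum>k\<in>{1..length ws}. \<Sum>\<sigma>\<in>unshuffles k (length ws - k).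
    koszul \<sigma> ws \<cdot> lmult (\<phi> (wprod (front \<sigma> k ws))) (rear \<sigma> k ws))"

definition coder :: "('k::field S \<Rightarrow> 'k W) \<Rightarrow> 'k S \<Rightarrow> 'k S"
  where "coder \<phi> = lin_ext (\<lambda>I. coder_word \<phi> (word I))"

text \<open>The bracket of \<open>\<alpha>\<close> of parity \<open>p\<close> and \<open>\<beta>\<close> of parity \<open>q\<close>.\<close>

definition bracket ::
    "nat \<Rightarrow> nat \<Rightarrow> ('k::field S \<Rightarrow> 'k W) \<Rightarrow> ('k S \<Rightarrow> 'k W) \<Rightarrow> ('k S \<Rightarrow> 'k W)"
  where "bracket p q \<alpha> \<beta> = (\<lambda>x. \<alpha> (coder \<beta> x) - (-1) ^ (p * q) \<cdot> \<beta> (coder \<alpha> x))"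

definition codifferential :: "('k::field S \<Rightarrow> 'k W) \<Rightarrow> bool"
  where "codifferential d \<longleftrightarrow> lin_map d \<and> map_of_parity mpar gpar 1 d \<and> bracket 1 1 d d = (\<lambda>_. 0)"

definition equivalent :: "('k::field S \<Rightarrow> 'k W) \<Rightarrow> ('k S \<Rightarrow> 'k W) \<Rightarrow> bool"
  where "equivalent d d' \<longleftrightarrow>
    (\<exists>G. coalg_automorphism G \<and> coder d' = inv G \<circ> coder d \<circ> G)"


section \<open>The codifferentials of the classification\<close>

text \<open>\<open>\<phi> I j\<close> is \<open>\<phi>\<^sup>I\<^sub>j\<close>, written \<open>\<psi>\<^sup>I\<^sub>j\<close> when odd.\<close>

definition \<phi> :: "nat \<times> nat \<times> nat \<Rightarrow> gen \<Rightarrow> 'k::field S \<Rightarrow> 'k W"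
  where "\<phi> I j = lin_ext (\<lambda>J. if Rep_mon J = I
    then (case I of (i1, i2, i3) \<Rightarrow> of_nat (fact i1 * fact i2 * fact i3) \<cdot> Poly_Mapping.single j 1)
    else 0)"

definition d_inf :: "nat \<Rightarrow> 'k::field S \<Rightarrow> 'k W"
  where "d_inf m = \<phi> (1, 1, m) W1"

definition d_lam :: "nat \<Rightarrow> 'k::field \<Rightarrow> 'k S \<Rightarrow> 'k W"
  where "d_lam m c = (\<lambda>x. \<phi> (0, 1, m + 1) W3 x + c \<cdot> \<phi> (1, 1, m) W1 x)"

definition d_star :: "nat \<Rightarrow> 'k::field S \<Rightarrow> 'k W"
  where "d_star m = \<phi> (0, 0, m + 2) W1"

definition d_sharp :: "nat \<Rightarrow> 'k::field S \<Rightarrow> 'k W"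
  where "d_sharp m = (\<lambda>x. \<phi> (0, 1, m + 1) W3 x + \<phi> (0, 0, m + 2) W1 x
    - of_nat (m + 2) \<cdot> \<phi> (1, 1, m) W1 x)"

definition normal_forms :: "nat \<Rightarrow> ('k::field S \<Rightarrow> 'k W) set"
  where "normal_forms m = {d_inf m, d_star m, d_sharp m} \<union> range (d_lam m)"

end

theory Submission
  imports Defs
begin

text \<open>An odd \<open>d \<in> L\<^bsub>m+2\<^esub>\<close> is given by three vectors \<open>a\<close>, \<open>b\<close>, \<open>c\<close> of the plane:
  \<open>d(w\<^sub>3^(m+2)) = a\<^sub>1w\<^sub>1 + a\<^sub>2w\<^sub>2\<close>, \<open>d(w\<^sub>1w\<^sub>2w\<^sub>3^m) = b\<^sub>1w\<^sub>1 + b\<^sub>2w\<^sub>2\<close> and \<open>d(w\<^sub>iw\<^sub>3^(m+1)) = c\<^sub>iw\<^sub>3\<close>.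
  The codifferential condition says that \<open>a\<close> and \<open>b\<close> are orthogonal to \<open>c\<close>, together with quadratic
  relations which force \<open>a = 0\<close> or \<open>b = 0\<close> if \<open>c = 0\<close>, and \<open>a = 0\<close> or
  \<open>(m+1) b = -(m+2) (c\<^sub>2, -c\<^sub>1)\<close> otherwise.

  Since \<open>d\<close> is homogeneous, a coalgebra automorphism acts on it only through its linear part, that is
  through a matrix \<open>A \<in> GL\<^sub>2\<close> on \<open>w\<^sub>1, w\<^sub>2\<close> and a scalar \<open>r \<noteq> 0\<close> on \<open>w\<^sub>3\<close>. Up to powers of \<open>r\<close> this
  replaces \<open>a\<close>, \<open>b\<close>, \<open>c\<close> by \<open>A\<^sup>-\<^sup>1 a\<close>, \<open>det A \<cdot> A\<^sup>-\<^sup>1 b\<close>, \<open>A\<^sup>T c\<close>. So the conditions \<open>a = 0\<close> and \<open>c = 0\<close> are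
  invariant, and so is the factor \<open>l\<close> in \<open>b = l (c\<^sub>2, -c\<^sub>1)\<close>; conversely matrices with \<open>r = 1\<close>
  suffice to reach the normal forms.\<close>

section \<open>Linear maps on spaces with a basis\<close>

abbreviation bas :: "'a \<Rightarrow> ('a \<Rightarrow>\<^sub>0 'k::field)"
  where "bas x \<equiv> Poly_Mapping.single x 1"

lemma lin_mapI:
  assumes "\<And>u v. f (u + v) = f u + f v" and "\<And>c v. f (c \<cdot> v) = c \<cdot> f v"
  shows "lin_map f"
  using assms by (simp add: Vector_Spaces.linear_iff scal.vector_space_axioms)

lemma lin_map_add: "lin_map f \<Longrightarrow> f (u + v) = f u + f v"
  by (simp add: Vector_Spaces.linear_iff)

lemma lin_map_scal: "lin_map f \<Longrightarrow> f (c \<cdot> v) = c \<cdot> f v"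
  by (simp add: Vector_Spaces.linear_iff)

lemma lin_map_0: "lin_map f \<Longrightarrow> f 0 = 0"
  using lin_map_scal[of f 0 0] by simp

lemma lin_map_minus: "lin_map f \<Longrightarrow> f (- v) = - f v"
  using lin_map_scal[of f "-1" v] by simp

lemma lin_map_diff: "lin_map f \<Longrightarrow> f (u - v) = f u - f v"
  using lin_map_add[of f u "- v"] by (simp add: lin_map_minus)

lemma lin_map_sum: "lin_map f \<Longrightarrow> f (\<Sum>i\<in>A. g i) = (\<Sum>i\<in>A. f (g i))"
  by (induction A rule: infinite_finite_induct) (auto simp: lin_map_0 lin_map_add)

lemmas lin_map_simps = lin_map_add lin_map_scal lin_map_0 lin_map_minus lin_map_diff lin_map_sum

lemma lin_map_comp: "lin_map f \<Longrightarrow> lin_map g \<Longrightarrow> lin_map (\<lambda>x. f (g x))"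
  by (rule lin_mapI) (simp_all add: lin_map_simps)

lemma lin_ext_superset:
  assumes "finite A" "Poly_Mapping.keys v \<subseteq> A"
  shows "lin_ext f v = (\<Sum>x\<in>A. Poly_Mapping.lookup v x \<cdot> f x)"
  unfolding lin_ext_def
  by (rule sum.mono_neutral_left) (use assms in \<open>auto simp: in_keys_iff\<close>)

lemma lin_map_lin_ext:
  fixes f :: "'a \<Rightarrow> ('b \<Rightarrow>\<^sub>0 'c::field)"
  shows "lin_map (lin_ext f)"
proof (rule lin_mapI)
  fix u v :: "'a \<Rightarrow>\<^sub>0 'c"
  let ?A = "Poly_Mapping.keys u \<union> Poly_Mapping.keys v"
  have "Poly_Mapping.keys (u + v) \<subseteq> ?A"
    by (rule Poly_Mapping.keys_add)
  then show "lin_ext f (u + v) = lin_ext f u + lin_ext f v"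
    by (simp add: lin_ext_superset[of ?A] lookup_add scal.scale_left_distrib sum.distrib)
next
  fix c and v :: "'a \<Rightarrow>\<^sub>0 'c"
  have "Poly_Mapping.keys (c \<cdot> v) \<subseteq> Poly_Mapping.keys v"
    by (auto simp: in_keys_iff)
  then show "lin_ext f (c \<cdot> v) = c \<cdot> lin_ext f v"
    by (simp add: lin_ext_superset[of "Poly_Mapping.keys v"] scal.scale_sum_right)
qed

lemma lin_ext_bas [simp]: "lin_ext f (bas x) = f x"
  by (simp add: lin_ext_def)

lemma lin_ext_0 [simp]: "lin_ext f 0 = 0"
  by (simp add: lin_ext_def)

lemma poly_mapping_expand:
  fixes v :: "'a \<Rightarrow>\<^sub>0 'k::field"
  shows "v = (\<Sum>x\<in>Poly_Mapping.keys v. Poly_Mapping.lookup v x \<cdot> bas x)"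
  by (rule poly_mapping_eqI)
    (auto simp: lookup_sum lookup_single when_def in_keys_iff if_distrib sum.delta cong: if_cong)

lemma lin_map_expand:
  assumes "lin_map f"
  shows "f v = (\<Sum>x\<in>Poly_Mapping.keys v. Poly_Mapping.lookup v x \<cdot> f (bas x))"
proof -
  have "f v = f (\<Sum>x\<in>Poly_Mapping.keys v. Poly_Mapping.lookup v x \<cdot> bas x)"
    using poly_mapping_expand[of v] by simp
  then show ?thesis by (simp only: lin_map_simps[OF assms])
qed

lemma lin_map_eqI:
  assumes "lin_map f" "lin_map g" "\<And>x. f (bas x) = g (bas x)"
  shows "f = g"
proof
  fix v
  show "f v = g v"
    unfolding lin_map_expand[OF assms(1), of v] lin_map_expand[OF assms(2), of v] assms(3) ..
qed

lemma homogeneous_0 [simp]: "homogeneous par p 0"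
  by (simp add: homogeneous_def)

lemma homogeneous_lookup:
  "homogeneous par p v \<longleftrightarrow> (\<forall>x. par x mod 2 \<noteq> p mod 2 \<longrightarrow> Poly_Mapping.lookup v x = 0)"
  by (auto simp: homogeneous_def in_keys_iff)

lemma map_of_parityI:
  fixes f :: "('a \<Rightarrow>\<^sub>0 'c::field) \<Rightarrow> ('b \<Rightarrow>\<^sub>0 'c)"
  assumes "lin_map f" "\<And>x. homogeneous par' (par x + q) (f (bas x))"
  shows "map_of_parity par par' q f"
  unfolding map_of_parity_def
proof (intro allI impI)
  fix p and v :: "'a \<Rightarrow>\<^sub>0 'c"
  assume hom: "homogeneous par p v"
  have "par' y mod 2 = (p + q) mod 2"
    if "x \<in> Poly_Mapping.keys v" "Poly_Mapping.lookup (f (bas x)) y \<noteq> 0" for x y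
  proof -
    have "par x mod 2 = p mod 2" using hom that(1) by (auto simp: homogeneous_def)
    then have "(par x + q) mod 2 = (p + q) mod 2" by (metis mod_add_cong)
    then show ?thesis
      using assms(2)[of x] that(2) by (auto simp: homogeneous_lookup)
  qed
  then show "homogeneous par' (p + q) (f v)"
    unfolding homogeneous_lookup lin_map_expand[OF assms(1), of v]
    by (fastforce simp: lookup_sum intro!: sum.neutral)
qed

lemma map_of_parityD:
  "map_of_parity par par' q f \<Longrightarrow> homogeneous par' (par x + q) (f (bas x))"
  unfolding map_of_parity_def by (elim allE[of _ "par x"] allE[of _ "bas x"]) (simp add: homogeneous_def)

subsection \<open>Tensor products\<close>

lemma lookup_tensor:
  "Poly_Mapping.lookup (tensor u v) (x, y) = Poly_Mapping.lookup u x * Poly_Mapping.lookup v y"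
proof -
  have "Poly_Mapping.lookup (tensor u v) (x, y) =
    (\<Sum>x'\<in>Poly_Mapping.keys u. \<Sum>y'\<in>Poly_Mapping.keys v. 
      if x' = x then if y' = y then Poly_Mapping.lookup u x * Poly_Mapping.lookup v y else 0 else 0)"
    by (auto simp: tensor_def lookup_sum lookup_single when_def intro!: sum.cong)
  also have "\<dots> = (\<Sum>x'\<in>Poly_Mapping.keys u. 
      if x' = x then \<Sum>y'\<in>Poly_Mapping.keys v. 
        if y' = y then Poly_Mapping.lookup u x * Poly_Mapping.lookup v y else 0 else 0)"
    by (intro sum.cong) auto
  also have "\<dots> = Poly_Mapping.lookup u x * Poly_Mapping.lookup v y"
    by (auto simp: sum.delta in_keys_iff)
  finally show ?thesis .
qed

lemma tensor_simps [simp]: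
  "tensor (u + u') v = tensor u v + tensor u' v"
  "tensor u (v + v') = tensor u v + tensor u v'"
  "tensor (c \<cdot> u) v = c \<cdot> tensor u v"
  "tensor u (c \<cdot> v) = c \<cdot> tensor u v"
  "tensor 0 v = 0"
  "tensor u 0 = 0"
  by (rule poly_mapping_eqI; simp add: lookup_tensor lookup_add algebra_simps split_paired_all)+

lemma tensor_sum:
  "tensor (\<Sum>i\<in>A. f i) v = (\<Sum>i\<in>A. tensor (f i) v)"
  "tensor v (\<Sum>i\<in>A. f i) = (\<Sum>i\<in>A. tensor v (f i))"
  by (induction A rule: infinite_finite_induct) auto

lemma tensor_bas: "tensor (bas x) (bas y) = bas (x, y)"
  by (simp add: tensor_def)

lemma lin_map_tensor_map: "lin_map (tensor_map f g)"
  unfolding tensor_map_def by (rule lin_map_lin_ext)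

text \<open>\<open>tensor_map\<close> is prescribed only on pairs of basis vectors; expanding both
  factors bilinearly carries the formula over to all pure tensors.\<close>

lemma tensor_map_tensor:
  assumes "lin_map f" "lin_map g"
  shows "tensor_map f g (tensor u v) = tensor (f u) (g v)"
proof -
  have [simp]: "tensor_map f g (bas (x, y)) = tensor (f (bas x)) (g (bas y))" for x y
    by (simp add: tensor_map_def)
  let ?s = "\<lambda>u. \<Sum>x\<in>Poly_Mapping.keys u. Poly_Mapping.lookup u x \<cdot> bas x"
  have "tensor_map f g (tensor u v) = tensor_map f g (tensor (?s u) (?s v))"
    using poly_mapping_expand[of u] poly_mapping_expand[of v] by simp
  also have "\<dots> = (\<Sum>x\<in>Poly_Mapping.keys u. \<Sum>y\<in>Poly_Mapping.keys v.
      Poly_Mapping.lookup u x \<cdot> Poly_Mapping.lookup v y \<cdot> tensor (f (bas x)) (g (bas y)))"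
    by (subst sum.swap) (simp add: tensor_sum tensor_bas lin_map_simps[OF lin_map_tensor_map]
        scal.scale_sum_right mult.commute)
  also have "\<dots> = tensor (f u) (g v)"
    unfolding lin_map_expand[OF assms(1), of u] lin_map_expand[OF assms(2), of v]
    by (subst sum.swap) (simp add: tensor_sum scal.scale_sum_right mult.commute)
  finally show ?thesis .
qed

section \<open>Sums over unshuffles\<close>

text \<open>An unshuffle is determined by the set \<open>A\<close> of positions sent to the front.
  Its inversions then correspond to the pairs in which a position outside \<open>A\<close> precedes
  one inside \<open>A\<close>.\<close>

definition koszul_subset :: "nat set \<Rightarrow> gen list \<Rightarrow> 'k::field"
  where "koszul_subset A ws = (-1) ^ card {(p, q). p < q \<and> q < length ws \<and> p \<notin> A \<and> q \<in> A \<and>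
    odd (gpar (ws ! p)) \<and> odd (gpar (ws ! q))}"

lemma set_nths_upt: "set (nths [0..<n] A) = A \<inter> {..<n}"
  by (force simp: set_nths)

text \<open>In each equation both sides are increasing lists with the same entries, and a finite set
  has only one increasing enumeration.\<close>

lemma unshuffle_lists:
  assumes "\<sigma> \<in> unshuffles k l"
  shows "map \<sigma> [0..<k] = nths [0..<k + l] (\<sigma> ` {..<k})"
    and "map \<sigma> [k..<k + l] = nths [0..<k + l] (- \<sigma> ` {..<k})"
proof -
  have perm: "\<sigma> permutes {..<k + l}"
    and mono: "strict_mono_on {..<k} \<sigma>" "strict_mono_on {k..<k + l} \<sigma>"
    using assms by (auto simp: unshuffles_def)
  have inj: "inj \<sigma>" and img: "\<sigma> ` {..<k + l} = {..<k + l}"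
    using perm by (auto simp: permutes_inj permutes_image)
  have sub: "\<sigma> ` {..<k} \<subseteq> {..<k + l}" using img by fastforce
  show "map \<sigma> [0..<k] = nths [0..<k + l] (\<sigma> ` {..<k})"
  proof (rule sorted_distinct_set_unique)
    show "sorted (map \<sigma> [0..<k])"
      using mono(1) by (auto simp: sorted_iff_nth_mono_less strict_mono_on_def intro!: less_imp_le)
    show "set (map \<sigma> [0..<k]) = set (nths [0..<k + l] (\<sigma> ` {..<k}))"
      using sub by (simp add: set_nths_upt Int_absorb2 lessThan_atLeast0)
  qed (use inj in \<open>auto simp: distinct_map sorted_nths intro: inj_on_subset\<close>)
  show "map \<sigma> [k..<k + l] = nths [0..<k + l] (- \<sigma> ` {..<k})"
  proof (rule sorted_distinct_set_unique)
    show "sorted (map \<sigma> [k..<k + l])"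
      using mono(2) by (auto simp: sorted_iff_nth_mono_less strict_mono_on_def intro!: less_imp_le)
    have "\<sigma> ` {k..<k + l} = \<sigma> ` ({..<k + l} - {..<k})"
      by (rule arg_cong[where f = "image \<sigma>"]) auto
    also have "\<dots> = {..<k + l} - \<sigma> ` {..<k}"
      using inj img by (metis image_set_diff)
    finally show "set (map \<sigma> [k..<k + l]) = set (nths [0..<k + l] (- \<sigma> ` {..<k}))"
      by (auto simp: set_nths_upt)
  qed (use inj in \<open>auto simp: distinct_map sorted_nths intro: inj_on_subset\<close>)
qed

lemma card_unshuffle_image: "\<sigma> \<in> unshuffles k l \<Longrightarrow> card (\<sigma> ` {..<k}) = k"
  by (metis (no_types, lifting) card_image card_lessThan inj_on_subset mem_Collect_eq permutes_inj
      subset_UNIV unshuffles_def)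

text \<open>Injectivity holds because the image of the first block fixes both value lists. The
  inverse sends \<open>A\<close> to the enumeration of \<open>A\<close> followed by that of its
  complement.\<close>

lemma bij_betw_unshuffles:
  "bij_betw (\<lambda>\<sigma>. \<sigma> ` {..<k}) (unshuffles k l) {A. A \<subseteq> {..<k + l} \<and> card A = k}"
proof (rule bij_betw_imageI)
  show "inj_on (\<lambda>\<sigma>. \<sigma> ` {..<k}) (unshuffles k l)"
  proof (rule inj_onI)
    fix \<sigma> \<tau> assume *: "\<sigma> \<in> unshuffles k l" "\<tau> \<in> unshuffles k l" "\<sigma> ` {..<k} = \<tau> ` {..<k}"
    have "map \<sigma> [0..<k] = map \<tau> [0..<k]" "map \<sigma> [k..<k + l] = map \<tau> [k..<k + l]"
      using * by (simp_all add: unshuffle_lists)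
    then have "\<sigma> i = \<tau> i" if "i < k + l" for i
      using that by (cases "i < k") auto
    moreover have "\<sigma> i = \<tau> i" if "\<not> i < k + l" for i
      using * that by (auto simp: unshuffles_def permutes_def)
    ultimately show "\<sigma> = \<tau>" by blast
  qed
  show "(\<lambda>\<sigma>. \<sigma> ` {..<k}) ` unshuffles k l = {A. A \<subseteq> {..<k + l} \<and> card A = k}"
  proof (intro equalityI subsetI)
    fix A assume "A \<in> (\<lambda>\<sigma>. \<sigma> ` {..<k}) ` unshuffles k l"
    then obtain \<sigma> where \<sigma>: "\<sigma> \<in> unshuffles k l" "A = \<sigma> ` {..<k}" by blast
    then have "\<sigma> ` {..<k + l} = {..<k + l}"
      by (auto simp: unshuffles_def permutes_image)
    then show "A \<in> {A. A \<subseteq> {..<k + l} \<and> card A = k}"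
      using \<sigma> by (auto simp: card_unshuffle_image)
  next
    fix A assume "A \<in> {A. A \<subseteq> {..<k + l} \<and> card A = k}"
    then have A: "A \<subseteq> {..<k + l}" "card A = k" by auto
    define u v where "u = nths [0..<k + l] A" and "v = nths [0..<k + l] (- A)"
    \<comment> \<open>Outside the word the identity is forced by \<open>permutes\<close>.\<close>
    define \<sigma> where "\<sigma> i = (if i < k + l then (u @ v) ! i else i)" for i
    have set_u: "set u = A" and set_v: "set v = {..<k + l} - A"
      using A by (auto simp: u_def v_def set_nths_upt)
    have dist: "distinct u" "distinct v" by (simp_all add: u_def v_def)
    have "sorted u" "sorted v" by (simp_all add: u_def v_def sorted_nths)
    then have strict: "sorted_wrt (<) u" "sorted_wrt (<) v"
      using dist by (simp_all add: strict_sorted_iff)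
    have len_u: "length u = k"
      using distinct_card[OF dist(1)] set_u A by simp
    have len_v: "length v = l"
      using distinct_card[OF dist(2)] set_v A by (simp add: card_Diff_subset finite_subset)
    have "bij_betw ((!) (u @ v)) {..<k + l} {..<k + l}"
      using dist set_u set_v A by (intro bij_betw_nth) (auto simp: len_u len_v)
    then have "bij_betw \<sigma> {..<k + l} {..<k + l}"
      by (rule bij_betw_cong[THEN iffD1, rotated]) (simp add: \<sigma>_def)
    then have "\<sigma> permutes {..<k + l}"
      by (rule bij_imp_permutes) (simp add: \<sigma>_def)
    moreover have "strict_mono_on {..<k} \<sigma>"
      using strict(1) by (auto simp: strict_mono_on_def \<sigma>_def nth_append len_u sorted_wrt_iff_nth_less)
    moreover have "strict_mono_on {k..<k + l} \<sigma>"
      using strict(2) by (auto simp: strict_mono_on_def \<sigma>_def nth_append len_u len_v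
          sorted_wrt_iff_nth_less)
    ultimately have "\<sigma> \<in> unshuffles k l" by (simp add: unshuffles_def)
    moreover have "\<sigma> ` {..<k} = set u"
      by (auto simp: \<sigma>_def nth_append len_u in_set_conv_nth image_iff)
    ultimately show "A \<in> (\<lambda>\<sigma>. \<sigma> ` {..<k}) ` unshuffles k l"
      using set_u by auto
  qed
qed

lemma nths_eq_map_nth: "nths ws A = map ((!) ws) (nths [0..<length ws] A)"
  by (metis map_nth nths_map)

lemma front_eq_nths:
  assumes "\<sigma> \<in> unshuffles k (length ws - k)" "k \<le> length ws"
  shows "front \<sigma> k ws = nths ws (\<sigma> ` {..<k})"
proof -
  have "front \<sigma> k ws = map ((!) ws) (map \<sigma> [0..<k])" by (simp add: front_def)
  also have "map \<sigma> [0..<k] = nths [0..<length ws] (\<sigma> ` {..<k})"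
    using unshuffle_lists(1)[OF assms(1)] assms(2) by simp
  finally show ?thesis by (simp only: nths_eq_map_nth[of ws "\<sigma> ` {..<k}"])
qed

lemma rear_eq_nths:
  assumes "\<sigma> \<in> unshuffles k (length ws - k)" "k \<le> length ws"
  shows "rear \<sigma> k ws = nths ws (- \<sigma> ` {..<k})"
proof -
  have "rear \<sigma> k ws = map ((!) ws) (map \<sigma> [k..<length ws])" by (simp add: rear_def)
  also have "map \<sigma> [k..<length ws] = nths [0..<length ws] (- \<sigma> ` {..<k})"
    using unshuffle_lists(2)[OF assms(1)] assms(2) by simp
  finally show ?thesis by (simp only: nths_eq_map_nth[of ws "- \<sigma> ` {..<k}"])
qed

text \<open>An unshuffle increases on each of its two blocks, so every inversion joins a position of
  the first block to one of the second.\<close>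

lemma koszul_eq_koszul_subset:
  assumes "\<sigma> \<in> unshuffles k (length ws - k)" "k \<le> length ws"
  shows "koszul \<sigma> ws = koszul_subset (\<sigma> ` {..<k}) ws"
proof -
  let ?n = "length ws"
  let ?P = "{(i, j). i < j \<and> j < ?n \<and> \<sigma> j < \<sigma> i \<and> odd (gpar (ws ! \<sigma> i)) \<and> odd (gpar (ws ! \<sigma> j))}"
  let ?Q = "{(p, q). p < q \<and> q < ?n \<and> p \<notin> \<sigma> ` {..<k} \<and> q \<in> \<sigma> ` {..<k} \<and>
    odd (gpar (ws ! p)) \<and> odd (gpar (ws ! q))}"
  have perm: "\<sigma> permutes {..<?n}"
    and mono: "strict_mono_on {..<k} \<sigma>" "strict_mono_on {k..<?n} \<sigma>"
    using assms by (auto simp: unshuffles_def)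
  have inj: "inj \<sigma>" using perm by (rule permutes_inj)
  have lt: "\<sigma> i < ?n \<longleftrightarrow> i < ?n" for i
    using permutes_in_image[OF perm, of i] by simp
  have inv: "i < k \<and> k \<le> j" if "i < j" "j < ?n" "\<sigma> j < \<sigma> i" for i j
  proof (rule ccontr)
    assume "\<not> (i < k \<and> k \<le> j)"
    then consider "j < k" | "k \<le> i" using that by linarith
    then have "\<sigma> i < \<sigma> j"
      using mono that by cases (auto simp: strict_mono_on_def)
    then show False using that by simp
  qed
  \<comment> \<open>An inversion reverses the order of the two values, so they are swapped to list
    the smaller one first.\<close>
  have "bij_betw (\<lambda>(i, j). (\<sigma> j, \<sigma> i)) ?P ?Q"
  proof (rule bij_betw_imageI)
    show "inj_on (\<lambda>(i, j). (\<sigma> j, \<sigma> i)) ?P"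
      using inj by (auto simp: inj_on_def)
    show "(\<lambda>(i, j). (\<sigma> j, \<sigma> i)) ` ?P = ?Q"
    proof (intro equalityI subsetI)
      fix x assume "x \<in> (\<lambda>(i, j). (\<sigma> j, \<sigma> i)) ` ?P"
      then obtain i j where x: "x = (\<sigma> j, \<sigma> i)" and ij: "(i, j) \<in> ?P" by auto
      then have "i < k" "k \<le> j" using inv[of i j] by auto
      then have "i < ?n" "\<sigma> i \<notin> \<sigma> ` {..<k} \<longleftrightarrow> i \<notin> {..<k}" "\<sigma> j \<notin> \<sigma> ` {..<k} \<longleftrightarrow> j \<notin> {..<k}"
        using assms(2) inj by (simp_all add: inj_image_mem_iff)
      then show "x \<in> ?Q" using x ij \<open>i < k\<close> \<open>k \<le> j\<close> lt[of i] by simp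
    next
      fix x assume Q: "x \<in> ?Q"
      obtain p i where x: "x = (p, \<sigma> i)" and i: "i < k" using Q by auto
      obtain j where j: "p = \<sigma> j" using perm by (metis permutes_surj surjD)
      have "\<sigma> j < \<sigma> i" "\<sigma> i < ?n" "\<sigma> j \<notin> \<sigma> ` {..<k}"
        using Q x j by auto
      moreover have "k \<le> j" using \<open>\<sigma> j \<notin> \<sigma> ` {..<k}\<close> by (meson imageI lessThan_iff not_less)
      moreover have "j < ?n" using \<open>\<sigma> j < \<sigma> i\<close> \<open>\<sigma> i < ?n\<close> lt[of j] by simp
      ultimately have "(i, j) \<in> ?P" using Q x i j by simp
      then show "x \<in> (\<lambda>(i, j). (\<sigma> j, \<sigma> i)) ` ?P"
        using x j by (force simp: image_iff)
    qed
  qed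
  then have "card ?P = card ?Q" by (rule bij_betw_same_card)
  then show ?thesis by (simp add: koszul_def koszul_subset_def)
qed

text \<open>For fixed \<open>k\<close> the unshuffles are the subsets of size \<open>k\<close>;
  letting \<open>k\<close> run from 0 to the length of the word collects all subsets.\<close>

lemma unshuffle_sum_eq_subset_sum:
  fixes F :: "gen list \<Rightarrow> gen list \<Rightarrow> ('b \<Rightarrow>\<^sub>0 'k::field)"
  shows "(\<Sum>k\<in>{0..length ws}. \<Sum>\<sigma>\<in>unshuffles k (length ws - k).
      koszul \<sigma> ws \<cdot> F (front \<sigma> k ws) (rear \<sigma> k ws))
    = (\<Sum>A\<in>Pow {..<length ws}. koszul_subset A ws \<cdot> F (nths ws A) (nths ws (- A)))"
proof -
  let ?n = "length ws"
  let ?f = "\<lambda>A. koszul_subset A ws \<cdot> F (nths ws A) (nths ws (- A))"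
  have "(\<Sum>\<sigma>\<in>unshuffles k (?n - k). koszul \<sigma> ws \<cdot> F (front \<sigma> k ws) (rear \<sigma> k ws))
      = (\<Sum>A\<in>{A \<in> Pow {..<?n}. card A = k}. ?f A)" if "k \<in> {0..?n}" for k
  proof -
    have "(\<Sum>\<sigma>\<in>unshuffles k (?n - k). koszul \<sigma> ws \<cdot> F (front \<sigma> k ws) (rear \<sigma> k ws))
        = (\<Sum>\<sigma>\<in>unshuffles k (?n - k). ?f (\<sigma> ` {..<k}))"
      using that by (intro sum.cong)
        (simp_all add: koszul_eq_koszul_subset front_eq_nths rear_eq_nths)
    also have "\<dots> = (\<Sum>A\<in>{A. A \<subseteq> {..<k + (?n - k)} \<and> card A = k}. ?f A)"
      by (rule sum.reindex_bij_betw[OF bij_betw_unshuffles])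
    finally show ?thesis using that by simp
  qed
  then have "(\<Sum>k\<in>{0..?n}. \<Sum>\<sigma>\<in>unshuffles k (?n - k).
      koszul \<sigma> ws \<cdot> F (front \<sigma> k ws) (rear \<sigma> k ws))
    = (\<Sum>k\<in>{0..?n}. \<Sum>A\<in>{A \<in> Pow {..<?n}. card A = k}. ?f A)"
    by (rule sum.cong[OF refl])
  also have "\<dots> = (\<Sum>A\<in>Pow {..<?n}. ?f A)"
    by (rule sum.group) (use card_mono[of "{..<?n}"] in \<open>auto\<close>)
  finally show ?thesis .
qed

section \<open>Unshuffle sums by recursion on the word\<close>

abbreviation odd_letter :: "gen \<Rightarrow> bool"
  where "odd_letter x \<equiv> odd (gpar x)"

text \<open>Distributes the letters of a word over two words, with the Koszul sign: a letter moved to the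
  second word passes the odd letters of the first one.\<close>

fun usum :: "gen list \<Rightarrow> (gen list \<Rightarrow> gen list \<Rightarrow> ('b \<Rightarrow>\<^sub>0 'k::field)) \<Rightarrow> ('b \<Rightarrow>\<^sub>0 'k)"
  where
    "usum [] F = F [] []"
  | "usum (x # xs) F = usum xs (\<lambda>u v. F (x # u) v) +
      usum xs (\<lambda>u v. (if odd_letter x then (-1) ^ length (filter odd_letter u) else 1) \<cdot> F u (x # v))"

text \<open>A first letter that stays in front overtakes nothing and is overtaken by nothing, so no
  new sign pair arises.\<close>

lemma koszul_subset_insert_0:
  "koszul_subset (insert 0 (Suc ` B)) (x # ws) = koszul_subset B ws"
proof -
  let ?P = "\<lambda>A ws. {(p, q). p < q \<and> q < length ws \<and> p \<notin> A \<and> q \<in> A \<and>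
    odd (gpar (ws ! p)) \<and> odd (gpar (ws ! q))}"
  have "?P (insert 0 (Suc ` B)) (x # ws) = map_prod Suc Suc ` ?P B ws" (is "?L = ?R")
  proof (intro equalityI subsetI)
    fix y assume y: "y \<in> ?L"
    obtain p q where pq: "y = (p, q)" by (cases y)
    have "p \<noteq> 0" "q \<noteq> 0" using y pq by auto
    then obtain p' q' where "p = Suc p'" "q = Suc q'" by (metis not0_implies_Suc)
    then show "y \<in> ?R" using y pq by auto
  qed auto
  then have "card (?P (insert 0 (Suc ` B)) (x # ws)) = card (?P B ws)"
    by (simp add: card_image prod.inj_map inj_on_subset[of _ UNIV])
  then show ?thesis by (simp only: koszul_subset_def)
qed

lemma length_filter_nths:
  "length (filter P (nths ws B)) = card {q. q < length ws \<and> q \<in> B \<and> P (ws ! q)}"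
proof -
  have "filter P (nths ws B) = map ((!) ws) (filter (\<lambda>q. P (ws ! q)) (nths [0..<length ws] B))"
    by (subst nths_eq_map_nth) (simp add: filter_map comp_def)
  then have "length (filter P (nths ws B)) = card (set (filter (\<lambda>q. P (ws ! q)) (nths [0..<length ws] B)))"
    by (subst distinct_card) auto
  also have "set (filter (\<lambda>q. P (ws ! q)) (nths [0..<length ws] B))
      = {q. q < length ws \<and> q \<in> B \<and> P (ws ! q)}"
    by (auto simp: set_nths_upt)
  finally show ?thesis .
qed

text \<open>The new pairs are those of position 0 with the odd letters of the front word, and they
  count only if the first letter is odd.\<close>

lemma koszul_subset_Suc_image:
  "koszul_subset (Suc ` B) (x # ws) =
    (if odd_letter x then (-1) ^ length (filter odd_letter (nths ws B)) else 1) * koszul_subset B ws"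
proof -
  let ?P = "\<lambda>A ws. {(p, q). p < q \<and> q < length ws \<and> p \<notin> A \<and> q \<in> A \<and>
    odd (gpar (ws ! p)) \<and> odd (gpar (ws ! q))}"
  let ?N = "{q. q < length ws \<and> q \<in> B \<and> odd_letter (ws ! q)}"
  let ?Z = "(\<lambda>q. (0::nat, Suc q)) ` (if odd_letter x then ?N else {})"
  have eq: "?P (Suc ` B) (x # ws) = map_prod Suc Suc ` ?P B ws \<union> ?Z" (is "?L = ?R")
  proof (intro equalityI subsetI)
    fix y assume y: "y \<in> ?L"
    obtain p q where pq: "y = (p, q)" by (cases y)
    obtain q' where "q = Suc q'" using y pq by auto
    then show "y \<in> ?R" using y pq by (cases p) auto
  qed (auto split: if_splits)
  have "?P B ws \<subseteq> {..<length ws} \<times> {..<length ws}" by auto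
  then have fin: "finite (?P B ws)" by (rule finite_subset) simp
  have "card ?Z = (if odd_letter x then card ?N else 0)"
    by (simp add: card_image inj_on_def)
  moreover have "card (?P (Suc ` B) (x # ws)) = card (?P B ws) + card ?Z"
    unfolding eq using fin
    by (subst card_Un_disjoint) (auto simp: card_image prod.inj_map inj_on_subset[of _ UNIV])
  ultimately show ?thesis
    by (simp add: koszul_subset_def length_filter_nths power_add mult.commute del: map_prod_def)
qed

lemma sum_Pow_lessThan_Suc:
  fixes f :: "nat set \<Rightarrow> 'b::comm_monoid_add"
  shows "(\<Sum>A\<in>Pow {..<Suc n}. f A) =
    (\<Sum>B\<in>Pow {..<n}. f (insert 0 (Suc ` B))) + (\<Sum>B\<in>Pow {..<n}. f (Suc ` B))"
proof -
  have inj: "inj_on ((`) Suc) X" for X :: "nat set set"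
    by (simp add: inj_image_eq_iff inj_on_def)
  have P: "Pow (Suc ` {..<n}) = (`) Suc ` Pow {..<n}"
    by (rule image_Pow_surj[symmetric]) simp
  have "(\<Sum>A\<in>Pow {..<Suc n}. f A) = (\<Sum>A\<in>Pow (insert 0 (Suc ` {..<n})). f A)"
    by (simp add: lessThan_Suc_eq_insert_0)
  also have "\<dots> = (\<Sum>A\<in>Pow (Suc ` {..<n}). f A) + (\<Sum>A\<in>insert 0 ` Pow (Suc ` {..<n}). f A)"
    unfolding Pow_insert by (rule sum.union_disjoint) auto
  also have "(\<Sum>A\<in>insert 0 ` Pow (Suc ` {..<n}). f A) = (\<Sum>A\<in>Pow (Suc ` {..<n}). f (insert 0 A))"
    by (rule sum.reindex_cong[of "insert 0"]) (auto intro!: inj_onI simp: insert_ident)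
  finally show ?thesis
    by (simp add: P sum.reindex[OF inj] add.commute)
qed

text \<open>The two summands in the recursion of \<open>usum\<close> are the subsets containing
  position 0 and those avoiding it.\<close>

lemma subset_sum_eq_usum:
  fixes F :: "gen list \<Rightarrow> gen list \<Rightarrow> ('b \<Rightarrow>\<^sub>0 'k::field)"
  shows "(\<Sum>A\<in>Pow {..<length ws}. koszul_subset A ws \<cdot> F (nths ws A) (nths ws (- A))) = usum ws F"
proof (induction ws arbitrary: F)
  case Nil
  show ?case by (simp add: koszul_subset_def)
next
  case (Cons x ws)
  have [simp]: "{j. Suc j \<in> Suc ` B} = B" "{j. Suc j \<notin> Suc ` B} = - B" for B
    by auto
  show ?case
    unfolding length_Cons sum_Pow_lessThan_Suc usum.simps Cons.IH[symmetric]
    by (simp add: koszul_subset_insert_0 koszul_subset_Suc_image nths_Cons mult.commute)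
qed

lemma unshuffle_sum_eq_usum:
  fixes F :: "gen list \<Rightarrow> gen list \<Rightarrow> ('b \<Rightarrow>\<^sub>0 'k::field)"
  shows "(\<Sum>k\<in>{0..length ws}. \<Sum>\<sigma>\<in>unshuffles k (length ws - k).
      koszul \<sigma> ws \<cdot> F (front \<sigma> k ws) (rear \<sigma> k ws)) = usum ws F"
  by (simp only: unshuffle_sum_eq_subset_sum subset_sum_eq_usum)

text \<open>Even letters produce no sign, so only the number \<open>a\<close> of letters put in
  front matters. The induction step is Pascal's rule.\<close>

lemma usum_replicate_W3:
  "usum (replicate n W3) F =
    (\<Sum>a\<le>n. of_nat (n choose a) \<cdot> F (replicate a W3) (replicate (n - a) W3))"
proof (induction n arbitrary: F)
  case 0
  show ?case by simp
next
  case (Suc n)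
  let ?f = "\<lambda>a b. F (replicate a W3) (replicate b W3)"
  have "usum (replicate (Suc n) W3) F =
      (\<Sum>a\<le>n. of_nat (n choose a) \<cdot> ?f (Suc a) (n - a)) +
      (\<Sum>a\<le>n. of_nat (n choose a) \<cdot> ?f a (Suc (n - a)))"
    by (simp add: Suc.IH)
  \<comment> \<open>The added term \<open>a = Suc n\<close> has binomial coefficient 0; it makes the
    index shift that follows possible.\<close>
  also have "(\<Sum>a\<le>n. of_nat (n choose a) \<cdot> ?f a (Suc (n - a))) =
      (\<Sum>a\<le>Suc n. of_nat (n choose a) \<cdot> ?f a (Suc n - a))"
    by (simp add: Suc_diff_le binomial_eq_0)
  also have "\<dots> = ?f 0 (Suc n) + (\<Sum>a\<le>n. of_nat (n choose Suc a) \<cdot> ?f (Suc a) (n - a))"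
    by (subst sum.atMost_Suc_shift) simp
  also have "(\<Sum>a\<le>n. of_nat (n choose a) \<cdot> ?f (Suc a) (n - a)) + \<dots>
      = ?f 0 (Suc n) + (\<Sum>a\<le>n. of_nat (Suc n choose Suc a) \<cdot> ?f (Suc a) (n - a))"
    by (simp add: sum.distrib scal.scale_left_distrib)
  also have "\<dots> = (\<Sum>a\<le>Suc n. of_nat (Suc n choose a) \<cdot> ?f a (Suc n - a))"
    by (subst sum.atMost_Suc_shift) simp
  finally show ?case .
qed

lemma filter_odd_replicate_W3 [simp]: "filter odd_letter (replicate n W3) = []"
  by (induction n) auto

section \<open>Monomials\<close>

text \<open>The four families contain every basis monomial. Only the power of the third generator is
  a parameter, since the odd generators occur at most once.\<close>

definition w3 :: "nat \<Rightarrow> 'k::field S" where "w3 n = wprod (replicate n W3)"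
definition w13 :: "nat \<Rightarrow> 'k::field S" where "w13 n = wprod (W1 # replicate n W3)"
definition w23 :: "nat \<Rightarrow> 'k::field S" where "w23 n = wprod (W2 # replicate n W3)"
definition w123 :: "nat \<Rightarrow> 'k::field S" where "w123 n = wprod (W1 # W2 # replicate n W3)"

lemma count_list_replicate [simp]: "count_list (replicate n x) y = (if x = y then n else 0)"
  by (induction n) auto

section \<open>The sorting sign of a word\<close>

definition inversions :: "gen list \<Rightarrow> (nat \<times> nat) set"
  where "inversions ws = {(i, j). i < j \<and> j < length ws \<and> ws ! i = W2 \<and> ws ! j = W1}"

lemma card_inversions_Nil: "card (inversions []) = 0"
  by (simp add: inversions_def)

text \<open>A letter put in front adds inversions only if it is \<open>W2\<close>, namely one for
  each later \<open>W1\<close>; the old ones are shifted by one position.\<close>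

lemma card_inversions_Cons:
  "card (inversions (x # ws)) = (if x = W2 then count_list ws W1 else 0) + card (inversions ws)"
proof -
  let ?N = "{j. j < length ws \<and> ws ! j = W1}"
  let ?Z = "(\<lambda>j. (0::nat, Suc j)) ` (if x = W2 then ?N else {})"
  have eq: "inversions (x # ws) = map_prod Suc Suc ` inversions ws \<union> ?Z" (is "?L = ?R")
  proof (intro equalityI subsetI)
    fix y assume y: "y \<in> ?L"
    obtain p q where pq: "y = (p, q)" by (cases y)
    obtain q' where "q = Suc q'" using y pq by (cases q) (auto simp: inversions_def)
    then show "y \<in> ?R" using y pq by (cases p) (auto simp: inversions_def)
  qed (auto simp: inversions_def split: if_splits)
  have "inversions ws \<subseteq> {..<length ws} \<times> {..<length ws}" by (auto simp: inversions_def)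
  then have fin: "finite (inversions ws)" by (rule finite_subset) simp
  have "count_list ws W1 = card ?N"
    by (simp add: count_list_eq_length_filter length_filter_conv_card eq_commute)
  then have "card ?Z = (if x = W2 then count_list ws W1 else 0)"
    by (simp add: card_image inj_on_def)
  moreover have "card ?L = card (inversions ws) + card ?Z"
    unfolding eq using fin
    by (subst card_Un_disjoint) (auto simp: card_image prod.inj_map inj_on_subset[of _ UNIV])
  ultimately show ?thesis by simp
qed

lemma card_inversions_replicate_W3: "card (inversions (replicate n W3)) = 0"
  by (induction n) (simp_all add: card_inversions_Nil card_inversions_Cons)

lemmas wprod_inversions = wprod_def[folded inversions_def]

lemma wprod_simps:
  "wprod [] = 0"
  "wprod (replicate n W3) = w3 n"
  "wprod (W1 # replicate n W3) = w13 n"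
  "wprod (W2 # replicate n W3) = w23 n"
  "wprod (W3 # replicate n W3) = w3 (Suc n)"
  "wprod (W1 # W2 # replicate n W3) = w123 n"
  "wprod (W2 # W1 # replicate n W3) = - w123 n"
  "wprod (W3 # W1 # replicate n W3) = w13 (Suc n)"
  "wprod (W3 # W2 # replicate n W3) = w23 (Suc n)"
  "wprod (W1 # W1 # ws) = 0"
  "wprod (W2 # W2 # ws) = 0"
  "wprod (W1 # W2 # W1 # ws) = 0"
  "wprod (W2 # W1 # W2 # ws) = 0"
  by (simp_all add: w3_def w13_def w23_def w123_def wprod_inversions card_inversions_Cons
      card_inversions_replicate_W3 single_uminus)

lemma monomials_Abs_mon:
  "w3 n = (if n = 0 then 0 else bas (Abs_mon (0, 0, n)))"
  "w13 n = bas (Abs_mon (1, 0, n))"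
  "w23 n = bas (Abs_mon (0, 1, n))"
  "w123 n = bas (Abs_mon (1, 1, n))"
  by (simp_all add: w3_def w13_def w23_def w123_def wprod_inversions card_inversions_Cons
      card_inversions_replicate_W3)

text \<open>There is no unit in S(W). This makes the boundary terms of the sums below vanish, so
  that they express the reduced coproduct.\<close>

lemma w3_0 [simp]: "w3 0 = 0"
  by (simp add: monomials_Abs_mon)

lemma mon_cases:
  obtains n where "I = Abs_mon (0, 0, Suc n)" | n where "I = Abs_mon (1, 0, n)"
    | n where "I = Abs_mon (0, 1, n)" | n where "I = Abs_mon (1, 1, n)"
proof -
  obtain i j n where I: "Rep_mon I = (i, j, n)" by (cases "Rep_mon I")
  have "i \<le> 1" "j \<le> 1" "1 \<le> i + j + n"
    using Rep_mon[of I] by (simp_all add: I)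
  moreover have "I = Abs_mon (i, j, n)" using Rep_mon_inverse[of I] by (simp add: I)
  ultimately show thesis
    using that by (cases n) (auto simp: le_Suc_eq)
qed

lemma Rep_Abs_mon [simp]:
  "Rep_mon (Abs_mon (0, 0, Suc n)) = (0, 0, Suc n)"
  "0 < n \<Longrightarrow> Rep_mon (Abs_mon (0, 0, n)) = (0, 0, n)"
  "Rep_mon (Abs_mon (1, 0, n)) = (1, 0, n)"
  "Rep_mon (Abs_mon (Suc 0, 0, n)) = (1, 0, n)"
  "Rep_mon (Abs_mon (0, 1, n)) = (0, 1, n)"
  "Rep_mon (Abs_mon (0, Suc 0, n)) = (0, 1, n)"
  "Rep_mon (Abs_mon (1, 1, n)) = (1, 1, n)"
  "Rep_mon (Abs_mon (Suc 0, Suc 0, n)) = (1, 1, n)"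
  by (simp_all add: Abs_mon_inverse)

lemma lin_ext_monomials:
  "lin_ext f (w3 n) = (if n = 0 then 0 else f (Abs_mon (0, 0, n)))"
  "lin_ext f (w13 n) = f (Abs_mon (1, 0, n))"
  "lin_ext f (w23 n) = f (Abs_mon (0, 1, n))"
  "lin_ext f (w123 n) = f (Abs_mon (1, 1, n))"
  by (simp_all add: monomials_Abs_mon lin_map_0[OF lin_map_lin_ext])

lemma lin_map_eq_on_monomials:
  fixes f g :: "'k::field S \<Rightarrow> ('a \<Rightarrow>\<^sub>0 'k)"
  assumes "lin_map f" "lin_map g"
    and "\<And>n. f (w3 n) = g (w3 n)" "\<And>n. f (w13 n) = g (w13 n)"
    and "\<And>n. f (w23 n) = g (w23 n)" "\<And>n. f (w123 n) = g (w123 n)"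
  shows "f = g"
proof (rule lin_map_eqI[OF assms(1,2)])
  fix I show "f (bas I) = g (bas I)"
    by (cases I rule: mon_cases) (use assms(3)[of "Suc _"] assms(4-6) in \<open>simp_all add: monomials_Abs_mon\<close>)
qed

section \<open>Explicit coproduct and coderivations\<close>

text \<open>The coproduct omits the unshuffles with an empty front or rear, whereas
  \<open>usum\<close> includes them; their terms vanish because the empty product is 0.\<close>

lemma coprod_word_eq_usum:
  "coprod_word ws = usum ws (\<lambda>u v. tensor (wprod u) (wprod v) :: mon \<times> mon \<Rightarrow>\<^sub>0 'k::field)"
proof -
  let ?g = "\<lambda>k. \<Sum>\<sigma>\<in>unshuffles k (length ws - k).
    koszul \<sigma> ws \<cdot> tensor (wprod (front \<sigma> k ws)) (wprod (rear \<sigma> k ws)) :: mon \<times> mon \<Rightarrow>\<^sub>0 'k"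
  have "?g 0 = 0" "?g (length ws) = 0"
    by (simp_all add: front_def rear_def wprod_simps)
  then have "(\<Sum>k\<in>{0..length ws}. ?g k) = (\<Sum>k\<in>{1..<length ws}. ?g k)"
    by (intro sum.mono_neutral_right) (auto simp: Suc_le_eq le_less)
  then show ?thesis
    by (simp add: coprod_word_def unshuffle_sum_eq_usum[symmetric])
qed

text \<open>Only the empty front has to be added here, and it contributes \<phi>(0) = 0. An empty
  rear is a genuine term of a coderivation.\<close>

lemma coder_word_eq_usum:
  fixes \<phi> :: "'k::field S \<Rightarrow> 'k W"
  assumes "lin_map \<phi>"
  shows "coder_word \<phi> ws = usum ws (\<lambda>u v. lmult (\<phi> (wprod u)) v)"
proof -
  let ?g = "\<lambda>k. \<Sum>\<sigma>\<in>unshuffles k (length ws - k).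
    koszul \<sigma> ws \<cdot> lmult (\<phi> (wprod (front \<sigma> k ws))) (rear \<sigma> k ws)"
  have "?g 0 = 0"
    by (simp add: front_def wprod_simps lin_map_0[OF assms] lmult_def lin_ext_def)
  then have "(\<Sum>k\<in>{0..length ws}. ?g k) = (\<Sum>k\<in>{1..length ws}. ?g k)"
    by (intro sum.mono_neutral_right) (auto simp: Suc_le_eq)
  then show ?thesis
    by (simp add: coder_word_def unshuffle_sum_eq_usum[symmetric])
qed

text \<open>The odd letters are distributed in all ways and the even ones give the binomial
  coefficient. The minus sign comes from moving \<open>W2\<close> past \<open>W1\<close>.\<close>

lemma coprod_monomials:
  "coprod (w3 n) = (\<Sum>a\<le>n. of_nat (n choose a) \<cdot> tensor (w3 a) (w3 (n - a)))"
  "coprod (w13 n) = (\<Sum>a\<le>n. of_nat (n choose a) \<cdot>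
    (tensor (w13 a) (w3 (n - a)) + tensor (w3 a) (w13 (n - a))))"
  "coprod (w23 n) = (\<Sum>a\<le>n. of_nat (n choose a) \<cdot>
    (tensor (w23 a) (w3 (n - a)) + tensor (w3 a) (w23 (n - a))))"
  "coprod (w123 n) = (\<Sum>a\<le>n. of_nat (n choose a) \<cdot>
    (tensor (w123 a) (w3 (n - a)) + tensor (w13 a) (w23 (n - a))
      - tensor (w23 a) (w13 (n - a)) + tensor (w3 a) (w123 (n - a))))"
proof -
  note eqs = coprod_def lin_ext_monomials word_def coprod_word_eq_usum usum_replicate_W3 wprod_simps
    sum.distrib scal.scale_right_distrib scal.scale_right_diff_distrib sum_subtractf sum_negf
  \<comment> \<open>For \<open>n = 0\<close> both sides vanish, because \<open>w3 0\<close> is not a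
    monomial but 0.\<close>
  show "coprod (w3 n) = (\<Sum>a\<le>n. of_nat (n choose a) \<cdot> tensor (w3 a) (w3 (n - a)))"
    by (cases n) (simp_all add: eqs del: replicate_Suc usum.simps)
  show "coprod (w13 n) = (\<Sum>a\<le>n. of_nat (n choose a) \<cdot>
    (tensor (w13 a) (w3 (n - a)) + tensor (w3 a) (w13 (n - a))))"
    by (simp add: eqs)
  show "coprod (w23 n) = (\<Sum>a\<le>n. of_nat (n choose a) \<cdot>
    (tensor (w23 a) (w3 (n - a)) + tensor (w3 a) (w23 (n - a))))"
    by (simp add: eqs)
  show "coprod (w123 n) = (\<Sum>a\<le>n. of_nat (n choose a) \<cdot>
    (tensor (w123 a) (w3 (n - a)) + tensor (w13 a) (w23 (n - a))
      - tensor (w23 a) (w13 (n - a)) + tensor (w3 a) (w123 (n - a))))"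
    by (simp add: eqs algebra_simps)
qed

lemma lin_map_coprod: "lin_map coprod"
  unfolding coprod_def by (rule lin_map_lin_ext)

lemma lin_map_coder: "lin_map (coder f)"
  unfolding coder_def by (rule lin_map_lin_ext)

lemma lmult_expand:
  "lmult x ws = Poly_Mapping.lookup x W1 \<cdot> wprod (W1 # ws) +
    Poly_Mapping.lookup x W2 \<cdot> wprod (W2 # ws) + Poly_Mapping.lookup x W3 \<cdot> wprod (W3 # ws)"
proof -
  have "Poly_Mapping.keys x \<subseteq> {W1, W2, W3}" using gen.exhaust by blast
  then show ?thesis
    by (simp add: lmult_def lin_ext_superset[of "{W1, W2, W3}"] add.assoc)
qed

section \<open>Homogeneous odd cochains and their coderivations\<close>

text \<open>The coordinates are the plain values on monomials, without the factor I! of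
  \<open>\<phi> I j\<close>; factorials therefore enter only with the normal forms.\<close>

definition odd_cochain ::
    "nat \<Rightarrow> 'k \<times> 'k \<Rightarrow> 'k \<times> 'k \<Rightarrow> 'k \<times> 'k \<Rightarrow> 'k::field S \<Rightarrow> 'k W"
  where "odd_cochain m a b c = lin_ext (\<lambda>I.
    if Rep_mon I = (0, 0, m + 2) then fst a \<cdot> bas W1 + snd a \<cdot> bas W2
    else if Rep_mon I = (1, 1, m) then fst b \<cdot> bas W1 + snd b \<cdot> bas W2
    else if Rep_mon I = (1, 0, m + 1) then fst c \<cdot> bas W3
    else if Rep_mon I = (0, 1, m + 1) then snd c \<cdot> bas W3
    else 0)"

lemma lin_map_odd_cochain: "lin_map (odd_cochain m a b c)"
  unfolding odd_cochain_def by (rule lin_map_lin_ext)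

lemma odd_cochain_monomials:
  "odd_cochain m a b c (w3 n) = (if n = m + 2 then fst a \<cdot> bas W1 + snd a \<cdot> bas W2 else 0)"
  "odd_cochain m a b c (w13 n) = (if n = m + 1 then fst c \<cdot> bas W3 else 0)"
  "odd_cochain m a b c (w23 n) = (if n = m + 1 then snd c \<cdot> bas W3 else 0)"
  "odd_cochain m a b c (w123 n) = (if n = m then fst b \<cdot> bas W1 + snd b \<cdot> bas W2 else 0)"
  by (auto simp: odd_cochain_def lin_ext_monomials)

text \<open>A homogeneous cochain is nonzero on a single power of the even generator in each family,
  so one summand survives. If \<open>k > n\<close>, both sides are 0.\<close>

lemma sum_binomial_delta:
  "(\<Sum>a\<le>n. of_nat (n choose a) \<cdot> (if a = k then f a else 0)) = of_nat (n choose k) \<cdot> f k"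
proof -
  have "(\<Sum>a\<le>n. of_nat (n choose a) \<cdot> (if a = k then f a else 0)) =
      (\<Sum>a\<le>n. if a = k then of_nat (n choose a) \<cdot> f a else 0)"
    by (intro sum.cong) auto
  then show ?thesis by (simp add: binomial_eq_0)
qed

lemma lmult_if: "lmult (if P then x else 0) ws = (if P then lmult x ws else 0)"
  by (simp add: lmult_def)

text \<open>Each binomial coefficient counts the choices of even letters fed into the cochain; the
  minus signs come from reordering \<open>W1\<close> and \<open>W2\<close>. Wherever a subtraction
  is truncated, its binomial coefficient is 0.\<close>

lemma coder_odd_cochain:
  fixes m :: nat and a b c :: "'k::field \<times> 'k"
  defines "D \<equiv> coder (odd_cochain m a b c)"
  shows "D (w3 n) = of_nat (n choose (m + 2)) \<cdot>
      (fst a \<cdot> w13 (n - (m + 2)) + snd a \<cdot> w23 (n - (m + 2)))"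
    and "D (w13 n) = (of_nat (n choose (m + 1)) * fst c) \<cdot> w3 (n - m)
      - (of_nat (n choose (m + 2)) * snd a) \<cdot> w123 (n - (m + 2))"
    and "D (w23 n) = (of_nat (n choose (m + 1)) * snd c) \<cdot> w3 (n - m)
      + (of_nat (n choose (m + 2)) * fst a) \<cdot> w123 (n - (m + 2))"
    and "D (w123 n) =
      (of_nat (n choose m) * fst b - of_nat (n choose (m + 1)) * snd c) \<cdot> w13 (n - m)
      + (of_nat (n choose m) * snd b + of_nat (n choose (m + 1)) * fst c) \<cdot> w23 (n - m)"
proof -
  \<comment> \<open>The cochain consumes \<open>m + 1\<close> even letters and returns one. The two
    exponents differ only for \<open>n \<le> m\<close>, where the coefficient vanishes.\<close>
  have shift: "(of_nat (n choose Suc m) * x) \<cdot> f (Suc (n - Suc m)) =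
      (of_nat (n choose Suc m) * x) \<cdot> f (n - m)" for x :: 'k and f :: "nat \<Rightarrow> 'k S"
    by (cases "n \<le> m") (simp_all add: binomial_eq_0 Suc_diff_Suc)
  note eqs = D_def coder_def lin_ext_monomials word_def coder_word_eq_usum[OF lin_map_odd_cochain]
    usum_replicate_W3 wprod_simps odd_cochain_monomials lmult_if sum_binomial_delta
  note eqs2 = wprod_simps lmult_expand lookup_add lookup_single scal.scale_right_distrib if_distrib[of "scal _"] sum_negf
    shift
  show "D (w3 n) = of_nat (n choose (m + 2)) \<cdot>
      (fst a \<cdot> w13 (n - (m + 2)) + snd a \<cdot> w23 (n - (m + 2)))"
  proof -
    have "D (w3 n) = coder_word (odd_cochain m a b c) (replicate n W3)"
      by (cases n) (simp_all add: D_def coder_def lin_ext_monomials word_def coder_word_def)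
    then show ?thesis
      by (simp add: eqs del: lookup_scal) (simp add: eqs2)
  qed
  show "D (w13 n) = (of_nat (n choose (m + 1)) * fst c) \<cdot> w3 (n - m)
      - (of_nat (n choose (m + 2)) * snd a) \<cdot> w123 (n - (m + 2))"
    by (simp add: eqs sum.distrib scal.scale_right_distrib if_distrib[of uminus] cong: if_cong)
      (simp add: eqs2)
  show "D (w23 n) = (of_nat (n choose (m + 1)) * snd c) \<cdot> w3 (n - m)
      + (of_nat (n choose (m + 2)) * fst a) \<cdot> w123 (n - (m + 2))"
    by (simp add: eqs sum.distrib scal.scale_right_distrib if_distrib[of uminus] cong: if_cong)
      (simp add: eqs2)
  show "D (w123 n) =
      (of_nat (n choose m) * fst b - of_nat (n choose (m + 1)) * snd c) \<cdot> w13 (n - m)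
      + (of_nat (n choose m) * snd b + of_nat (n choose (m + 1)) * fst c) \<cdot> w23 (n - m)"
    by (simp add: eqs sum.distrib scal.scale_right_distrib cong: if_cong)
      (simp add: eqs2 algebra_simps binomial_eq_0 not_le Suc_le_eq Suc_diff_Suc cong: if_cong)
qed

text \<open>\<open>S(g)\<close> for \<open>g(w\<^sub>1) = p w\<^sub>1 + q w\<^sub>2\<close>, \<open>g(w\<^sub>2) = s w\<^sub>1 + t w\<^sub>2\<close>, \<open>g(w\<^sub>3) = r w\<^sub>3\<close>.\<close>

definition sym_map :: "'k::field \<Rightarrow> 'k \<Rightarrow> 'k \<Rightarrow> 'k \<Rightarrow> 'k \<Rightarrow> 'k S \<Rightarrow> 'k S"
  where "sym_map p q s t r = lin_ext (\<lambda>I. case Rep_mon I of (i, j, n) \<Rightarrow>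
    r ^ n \<cdot> (if i = 0 \<and> j = 0 then w3 n
      else if j = 0 then p \<cdot> w13 n + q \<cdot> w23 n
      else if i = 0 then s \<cdot> w13 n + t \<cdot> w23 n
      else (p * t - q * s) \<cdot> w123 n))"

lemma lin_map_sym_map: "lin_map (sym_map p q s t r)"
  unfolding sym_map_def by (rule lin_map_lin_ext)

lemma sym_map_monomials:
  "sym_map p q s t r (w3 n) = r ^ n \<cdot> w3 n"
  "sym_map p q s t r (w13 n) = r ^ n \<cdot> (p \<cdot> w13 n + q \<cdot> w23 n)"
  "sym_map p q s t r (w23 n) = r ^ n \<cdot> (s \<cdot> w13 n + t \<cdot> w23 n)"
  "sym_map p q s t r (w123 n) = r ^ n \<cdot> (p * t - q * s) \<cdot> w123 n"
  by (simp_all add: sym_map_def lin_ext_monomials)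

text \<open>The coproduct is natural with respect to linear maps of W. In coordinates the identity
  holds summand by summand, since the powers of \<open>r\<close> multiply.\<close>

lemma coprod_sym_map:
  fixes p q s t r :: "'a::field"
  shows "coprod (sym_map p q s t r x) = tensor_map (sym_map p q s t r) (sym_map p q s t r) (coprod x)"
proof -
  let ?G = "sym_map p q s t r"
  \<comment> \<open>Writing \<open>n = a + k\<close> removes the natural number subtraction from the
    comparison of summands.\<close>
  have step: "(\<Sum>a\<le>n. f a (n - a)) = (\<Sum>a\<le>n. g a (n - a))"
    if "\<And>a k. n = a + k \<Longrightarrow> f a k = g a k" for n and f g :: "nat \<Rightarrow> nat \<Rightarrow> mon \<times> mon \<Rightarrow>\<^sub>0 'a"
    by (rule sum.cong) (simp_all add: that)
  note lin = lin_map_simps[OF lin_map_tensor_map] lin_map_simps[OF lin_map_sym_map]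
    lin_map_simps[OF lin_map_coprod] tensor_map_tensor[OF lin_map_sym_map lin_map_sym_map]
    scal.scale_sum_right
  have "(\<lambda>x. coprod (?G x)) = (\<lambda>x. tensor_map ?G ?G (coprod x))"
  proof (rule lin_map_eq_on_monomials)
    show "lin_map (\<lambda>x. coprod (?G x))" "lin_map (\<lambda>x. tensor_map ?G ?G (coprod x))"
      by (rule lin_map_comp[OF lin_map_coprod lin_map_sym_map]
          lin_map_comp[OF lin_map_tensor_map lin_map_coprod])+
  next
    fix n
    show "coprod (?G (w3 n)) = tensor_map ?G ?G (coprod (w3 n))"
      unfolding lin sym_map_monomials coprod_monomials sum.distrib[symmetric]
      by (rule step, rule poly_mapping_eqI)
        (simp add: lookup_add lookup_minus power_add algebra_simps)
    show "coprod (?G (w13 n)) = tensor_map ?G ?G (coprod (w13 n))"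
      unfolding lin sym_map_monomials coprod_monomials sum.distrib[symmetric]
      by (rule step, rule poly_mapping_eqI)
        (simp add: lookup_add lookup_minus power_add algebra_simps)
    show "coprod (?G (w23 n)) = tensor_map ?G ?G (coprod (w23 n))"
      unfolding lin sym_map_monomials coprod_monomials sum.distrib[symmetric]
      by (rule step, rule poly_mapping_eqI)
        (simp add: lookup_add lookup_minus power_add algebra_simps)
    show "coprod (?G (w123 n)) = tensor_map ?G ?G (coprod (w123 n))"
      unfolding lin sym_map_monomials coprod_monomials
    proof (rule step)
      fix a k assume n: "n = a + k"
      let ?B = "tensor (p \<cdot> w13 a + q \<cdot> w23 a) (s \<cdot> w13 k + t \<cdot> w23 k)"
      let ?B' = "tensor (s \<cdot> w13 a + t \<cdot> w23 a) (p \<cdot> w13 k + q \<cdot> w23 k)"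
      \<comment> \<open>Antisymmetrising the two mixed tensors produces the determinant by which the
        map acts on the product of the odd generators.\<close>
      have "?B = ?B' + (p * t - q * s) \<cdot> (tensor (w13 a) (w23 k) - tensor (w23 a) (w13 k))"
        by (rule poly_mapping_eqI) (simp add: lookup_add lookup_minus algebra_simps)
      then show "r ^ n \<cdot> (p * t - q * s) \<cdot> of_nat (n choose a) \<cdot>
          (tensor (w123 a) (w3 k) + tensor (w13 a) (w23 k) - tensor (w23 a) (w13 k)
            + tensor (w3 a) (w123 k))
        = of_nat (n choose a) \<cdot>
          (tensor (r ^ a \<cdot> (p * t - q * s) \<cdot> w123 a) (r ^ k \<cdot> w3 k)
          + tensor (r ^ a \<cdot> (p \<cdot> w13 a + q \<cdot> w23 a)) (r ^ k \<cdot> (s \<cdot> w13 k + t \<cdot> w23 k))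
          - tensor (r ^ a \<cdot> (s \<cdot> w13 a + t \<cdot> w23 a)) (r ^ k \<cdot> (p \<cdot> w13 k + q \<cdot> w23 k))
          + tensor (r ^ a \<cdot> w3 a) (r ^ k \<cdot> (p * t - q * s) \<cdot> w123 k))"
        by (simp only: tensor_simps(3,4) n power_add)
          (rule poly_mapping_eqI, simp only: lookup_scal lookup_add lookup_minus, simp add: algebra_simps)
    qed
  qed
  then show ?thesis by (rule fun_cong)
qed

section \<open>Degree and parity\<close>

lemma mdeg_Abs_mon [simp]:
  "mdeg (Abs_mon (0, 0, Suc n)) = Suc n"
  "mdeg (Abs_mon (Suc 0, 0, n)) = Suc n"
  "mdeg (Abs_mon (0, Suc 0, n)) = Suc n"
  "mdeg (Abs_mon (Suc 0, Suc 0, n)) = Suc (Suc n)"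
  by (simp_all add: mdeg_def)

lemma mpar_Abs_mon [simp]:
  "mpar (Abs_mon (0, 0, Suc n)) = 0"
  "mpar (Abs_mon (Suc 0, 0, n)) = 1"
  "mpar (Abs_mon (0, Suc 0, n)) = 1"
  "mpar (Abs_mon (Suc 0, Suc 0, n)) = 2"
  by (simp_all add: mpar_def)

lemma mdeg_pos: "0 < mdeg I"
  by (cases I rule: mon_cases) simp_all

text \<open>The first formula also covers \<open>n = 0\<close>: then \<open>w3 n\<close> is 0, and
  no monomial has index (0, 0, 0).\<close>

lemma lookup_monomials:
  "Poly_Mapping.lookup (w3 n) I = (if Rep_mon I = (0, 0, n) then 1 else 0)"
  "Poly_Mapping.lookup (w13 n) I = (if Rep_mon I = (1, 0, n) then 1 else 0)"
  "Poly_Mapping.lookup (w23 n) I = (if Rep_mon I = (0, 1, n) then 1 else 0)"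
  "Poly_Mapping.lookup (w123 n) I = (if Rep_mon I = (1, 1, n) then 1 else 0)"
  by (cases I rule: mon_cases; cases n; auto simp: monomials_Abs_mon lookup_single when_def
      dest!: arg_cong[of "Abs_mon _" _ Rep_mon])+

lemma W_expand:
  "x = Poly_Mapping.lookup x W1 \<cdot> bas W1 + Poly_Mapping.lookup x W2 \<cdot> bas W2
    + Poly_Mapping.lookup x W3 \<cdot> bas W3"
proof (rule poly_mapping_eqI)
  fix k show "Poly_Mapping.lookup x k = Poly_Mapping.lookup (Poly_Mapping.lookup x W1 \<cdot> bas W1
      + Poly_Mapping.lookup x W2 \<cdot> bas W2 + Poly_Mapping.lookup x W3 \<cdot> bas W3) k"
    by (cases k) (simp_all add: lookup_add lookup_single)
qed

lemma homogeneous_W: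
  "homogeneous gpar p x \<longleftrightarrow> (if odd p then Poly_Mapping.lookup x W3 = 0
    else Poly_Mapping.lookup x W1 = 0 \<and> Poly_Mapping.lookup x W2 = 0)"
proof -
  have "(\<forall>y. P y) \<longleftrightarrow> P W1 \<and> P W2 \<and> P W3" for P
    by (metis gen.exhaust)
  then show ?thesis
    by (auto simp: homogeneous_lookup odd_iff_mod_2_eq_one even_iff_mod_2_eq_zero)
qed

lemma L_eq_0:
  assumes "d \<in> L n" "\<And>I. mdeg I = n \<Longrightarrow> Poly_Mapping.lookup x I = 0"
  shows "d x = 0"
proof -
  have "\<forall>I\<in>Poly_Mapping.keys x. mdeg I \<noteq> n"
    using assms(2) by (auto simp: in_keys_iff)
  then show ?thesis using assms(1) by (simp add: L_def)
qed

lemma odd_cochain_in_L: "odd_cochain m a b c \<in> L (m + 2)"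
proof -
  have "odd_cochain m a b c p = 0" if p: "\<forall>I\<in>Poly_Mapping.keys p. mdeg I \<noteq> m + 2" for p
    unfolding odd_cochain_def lin_ext_def
  proof (intro sum.neutral ballI)
    fix I assume "I \<in> Poly_Mapping.keys p"
    then have "mdeg I \<noteq> m + 2" using p by blast
    then have "Rep_mon I \<notin> {(0, 0, m + 2), (1, 1, m), (1, 0, m + 1), (0, 1, m + 1)}"
      by (auto simp: mdeg_def)
    then show "Poly_Mapping.lookup p I \<cdot> (if Rep_mon I = (0, 0, m + 2) then fst a \<cdot> bas W1 + snd a \<cdot> bas W2
      else if Rep_mon I = (1, 1, m) then fst b \<cdot> bas W1 + snd b \<cdot> bas W2
      else if Rep_mon I = (1, 0, m + 1) then fst c \<cdot> bas W3
      else if Rep_mon I = (0, 1, m + 1) then snd c \<cdot> bas W3 else 0) = 0"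
      by simp
  qed
  then show ?thesis by (simp add: L_def lin_map_odd_cochain)
qed

lemma odd_cochain_parity: "map_of_parity mpar gpar 1 (odd_cochain m a b c)"
proof (rule map_of_parityI[OF lin_map_odd_cochain])
  fix I
  show "homogeneous gpar (mpar I + 1) (odd_cochain m a b c (bas I))"
    by (cases I rule: mon_cases)
      (simp_all add: homogeneous_W odd_cochain_def lookup_add lookup_single)
qed

text \<open>The degree leaves one monomial in each of the four families. Oddness sends the even ones
  into the span of \<open>W1\<close> and \<open>W2\<close> and the odd ones into that of
  \<open>W3\<close>.\<close>

lemma odd_element_eq_odd_cochain:
  assumes d: "d \<in> L (m + 2)" "map_of_parity mpar gpar 1 d"
  obtains a1 a2 b1 b2 c1 c2 where "d = odd_cochain m (a1, a2) (b1, b2) (c1, c2)"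
proof -
  let ?l = "Poly_Mapping.lookup"
  let ?a = "d (w3 (m + 2))" and ?b = "d (w123 m)"
  let ?d' = "odd_cochain m (?l ?a W1, ?l ?a W2) (?l ?b W1, ?l ?b W2)
      (?l (d (w13 (m + 1))) W3, ?l (d (w23 (m + 1))) W3)"
  have lin: "lin_map d" using d(1) by (simp add: L_def)
  have zero: "d (bas I) = 0" if "mdeg I \<noteq> m + 2" for I
    using that by (intro L_eq_0[OF d(1)]) (auto simp: lookup_single when_def)
  have hom: "homogeneous gpar (mpar I + 1) (d (bas I))" for I
    by (rule map_of_parityD[OF d(2)])
  have "d = ?d'"
  proof (rule lin_map_eq_on_monomials[OF lin lin_map_odd_cochain])
    fix n
    have "d (w3 n) = 0" if "n \<noteq> m + 2"
      using that zero[of "Abs_mon (0, 0, n)"] by (cases n) (auto simp: monomials_Abs_mon lin_map_0[OF lin])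
    moreover have "?l (d (w3 (m + 2))) W3 = 0"
      using hom[of "Abs_mon (0, 0, m + 2)"] by (simp add: homogeneous_W monomials_Abs_mon)
    ultimately show "d (w3 n) = ?d' (w3 n)"
      using W_expand[of "d (w3 (m + 2))"] by (simp add: odd_cochain_monomials)
    have "d (w13 n) = 0" if "n \<noteq> m + 1"
      using that zero[of "Abs_mon (1, 0, n)"] by (simp add: monomials_Abs_mon)
    moreover have "?l (d (w13 (m + 1))) W1 = 0 \<and> ?l (d (w13 (m + 1))) W2 = 0"
      using hom[of "Abs_mon (1, 0, m + 1)"] by (simp add: homogeneous_W monomials_Abs_mon)
    ultimately show "d (w13 n) = ?d' (w13 n)"
      using W_expand[of "d (w13 (m + 1))"] by (simp add: odd_cochain_monomials)
    have "d (w23 n) = 0" if "n \<noteq> m + 1"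
      using that zero[of "Abs_mon (0, 1, n)"] by (simp add: monomials_Abs_mon)
    moreover have "?l (d (w23 (m + 1))) W1 = 0 \<and> ?l (d (w23 (m + 1))) W2 = 0"
      using hom[of "Abs_mon (0, 1, m + 1)"] by (simp add: homogeneous_W monomials_Abs_mon)
    ultimately show "d (w23 n) = ?d' (w23 n)"
      using W_expand[of "d (w23 (m + 1))"] by (simp add: odd_cochain_monomials)
    have "d (w123 n) = 0" if "n \<noteq> m"
      using that zero[of "Abs_mon (1, 1, n)"] by (simp add: monomials_Abs_mon)
    moreover have "?l (d (w123 m)) W3 = 0"
      using hom[of "Abs_mon (1, 1, m)"] by (simp add: homogeneous_W monomials_Abs_mon)
    ultimately show "d (w123 n) = ?d' (w123 n)"
      using W_expand[of "d (w123 m)"] by (simp add: odd_cochain_monomials)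
  qed
  then show thesis by (rule that)
qed

section \<open>Codifferentials in coordinates\<close>

text \<open>The composite of d with its coderivation can be nonzero only in degree 2m + 3. The two
  orthogonality relations come from \<open>w3\<close> and \<open>w123\<close>, the four quadratic
  ones from \<open>w13\<close> and \<open>w23\<close>.\<close>

lemma codifferential_odd_cochain_iff:
  fixes a1 a2 b1 b2 c1 c2 :: "'k::field_char_0" and m :: nat
  shows "codifferential (odd_cochain m (a1, a2) (b1, b2) (c1, c2)) \<longleftrightarrow>
    a1 * c1 + a2 * c2 = 0 \<and> b1 * c1 + b2 * c2 = 0 \<and>
    of_nat (m + 2) * c1 * a1 = of_nat (m + 1) * a2 * b1 \<and>
    of_nat (m + 2) * c1 * a2 = of_nat (m + 1) * a2 * b2 \<and>
    of_nat (m + 2) * c2 * a1 = - (of_nat (m + 1) * a1 * b1) \<and>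
    of_nat (m + 2) * c2 * a2 = - (of_nat (m + 1) * a1 * b2)" (is "_ \<longleftrightarrow> ?E")
proof -
  let ?d = "odd_cochain m (a1, a2) (b1, b2) (c1, c2)"
  let ?D = "coder ?d"
  let ?B = "of_nat ((2 * m + 2) choose (m + 1)) :: 'k"
  let ?B' = "of_nat ((2 * m + 2) choose (m + 2)) :: 'k"
  \<comment> \<open>This ratio of the two binomial coefficients is the source of the factors
    \<open>m + 2\<close> and \<open>m + 1\<close> in the quadratic relations.\<close>
  have "(m + 2) * ((2 * m + 2) choose (m + 2)) = (m + 1) * ((2 * m + 2) choose (m + 1))"
    using binomial_absorb_comp[of "2 * m + 2" "m + 1"] binomial_absorption[of "m + 1" "2 * m + 2"]
    by simp
  then have BB: "of_nat (m + 2) * ?B' = of_nat (m + 1) * ?B"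
    by (metis of_nat_mult)
  have nz: "?B \<noteq> 0" "?B' \<noteq> 0" "of_nat (m + 2) \<noteq> (0::'k)"
    by (simp_all add: zero_less_binomial_iff del: of_nat_Suc of_nat_add)
  note eqs = coder_odd_cochain lin_map_simps[OF lin_map_odd_cochain] odd_cochain_monomials
    lookup_add lookup_minus
  have dD_w3: "?d (?D (w3 n)) = (if n = 2 * m + 3
      then (of_nat (n choose (m + 2)) * (a1 * c1 + a2 * c2)) \<cdot> bas W3 else 0)" for n
  proof -
    have "n - (m + 2) = m + 1 \<longleftrightarrow> n = 2 * m + 3" by auto
    then show ?thesis
      unfolding eqs by (simp add: scal.scale_right_distrib distrib_left scal.scale_left_distrib mult.assoc)
  qed
  have dD_w13: "?d (?D (w13 n)) = (if n = 2 * m + 2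
      then (?B * c1 * a1 - ?B' * a2 * b1) \<cdot> bas W1 + (?B * c1 * a2 - ?B' * a2 * b2) \<cdot> bas W2
      else 0)" for n
  proof -
    have "n - m = m + 2 \<longleftrightarrow> n = 2 * m + 2" by auto
    \<comment> \<open>If \<open>m = 0\<close>, truncated subtraction gives
      \<open>n - (m + 2) = m\<close> for small \<open>n\<close> as well, but there the binomial
      coefficient is 0.\<close>
    moreover have "n choose (m + 2) = 0 \<or> (n - (m + 2) = m \<longleftrightarrow> n = 2 * m + 2)"
      by (auto simp: binomial_eq_0_iff)
    ultimately show ?thesis
      unfolding eqs by (auto simp: scal.scale_right_distrib scal.scale_left_diff_distrib mult.assoc
          simp del: binomial_Suc_Suc)
  qed
  have dD_w23: "?d (?D (w23 n)) = (if n = 2 * m + 2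
      then (?B * c2 * a1 + ?B' * a1 * b1) \<cdot> bas W1 + (?B * c2 * a2 + ?B' * a1 * b2) \<cdot> bas W2
      else 0)" for n
  proof -
    have "n - m = m + 2 \<longleftrightarrow> n = 2 * m + 2" by auto
    moreover have "n choose (m + 2) = 0 \<or> (n - (m + 2) = m \<longleftrightarrow> n = 2 * m + 2)"
      by (auto simp: binomial_eq_0_iff)
    ultimately show ?thesis
      unfolding eqs by (auto simp: scal.scale_right_distrib scal.scale_left_distrib mult.assoc
          simp del: binomial_Suc_Suc)
  qed
  have dD_w123: "?d (?D (w123 n)) = (if n = 2 * m + 1
      then (of_nat (n choose m) * (b1 * c1 + b2 * c2)) \<cdot> bas W3 else 0)" for n
  proof -
    have "n - m = m + 1 \<longleftrightarrow> n = 2 * m + 1" by auto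
    \<comment> \<open>The terms quadratic in c cancel, which leaves only the pairing of b with
      c.\<close>
    moreover have "(of_nat (n choose m) * b1 - of_nat (n choose (m + 1)) * c2) * c1
        + (of_nat (n choose m) * b2 + of_nat (n choose (m + 1)) * c1) * c2
        = of_nat (n choose m) * (b1 * c1 + b2 * c2)"
      by (simp add: algebra_simps)
    moreover have "?d (?D (w123 n)) = (if n - m = m + 1 then
        ((of_nat (n choose m) * b1 - of_nat (n choose (m + 1)) * c2) * c1
        + (of_nat (n choose m) * b2 + of_nat (n choose (m + 1)) * c1) * c2) \<cdot> bas W3 else 0)"
      unfolding eqs by (simp add: scal.scale_left_distrib distrib_right)
    ultimately show ?thesis by (simp only:)
  qed
  have scale: "?B * x = ?B' * y \<longleftrightarrow> of_nat (m + 2) * x = of_nat (m + 1) * y" for x y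
  proof -
    have "?B * x = ?B' * y \<longleftrightarrow> of_nat (m + 2) * (?B * x) = of_nat (m + 2) * (?B' * y)"
      using nz by (simp del: of_nat_add)
    also have "of_nat (m + 2) * (?B' * y) = ?B * (of_nat (m + 1) * y)"
      using BB by (simp add: mult.assoc[symmetric] mult.commute)
    also have "of_nat (m + 2) * (?B * x) = ?B * (of_nat (m + 2) * x)" by (simp add: mult.left_commute)
    finally show ?thesis using nz(1) by simp
  qed
  have scale_plus: "?B * x + ?B' * y = 0 \<longleftrightarrow> of_nat (m + 2) * x = of_nat (m + 1) * - y" for x y
    using scale[of x "- y"] by (simp only: mult_minus_right eq_neg_iff_add_eq_0)
  \<comment> \<open>For odd d the sign in the bracket is -1, so the two terms add up; the factor 2
    is invertible in characteristic zero.\<close>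
  have "bracket 1 1 ?d ?d x = 2 \<cdot> ?d (?D x)" for x
    by (rule poly_mapping_eqI) (simp add: bracket_def lookup_add)
  then have "bracket 1 1 ?d ?d = (\<lambda>_. 0) \<longleftrightarrow> (\<forall>x. ?d (?D x) = 0)"
    by (auto simp: fun_eq_iff)
  also have "\<dots> \<longleftrightarrow> (\<forall>n. ?d (?D (w3 n)) = 0) \<and> (\<forall>n. ?d (?D (w13 n)) = 0) \<and>
      (\<forall>n. ?d (?D (w23 n)) = 0) \<and> (\<forall>n. ?d (?D (w123 n)) = 0)" (is "_ \<longleftrightarrow> ?R")
  proof
    assume R: ?R
    have "(\<lambda>x. ?d (?D x)) = (\<lambda>x. 0)"
      by (rule lin_map_eq_on_monomials[OF lin_map_comp[OF lin_map_odd_cochain lin_map_coder]])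
        (use R in \<open>auto intro!: lin_mapI\<close>)
    then show "\<forall>x. ?d (?D x) = 0" by meson
  qed blast
  also have "\<dots> \<longleftrightarrow> ?E"
  proof -
    have eqW: "x \<cdot> bas W1 + y \<cdot> bas W2 = 0 \<longleftrightarrow> x = 0 \<and> y = 0" "x \<cdot> bas W3 = 0 \<longleftrightarrow> x = 0"
      for x y :: 'k
      by (auto simp: poly_mapping_eq_iff fun_eq_iff lookup_add lookup_single when_def)
    have all_if: "(\<forall>n. (if n = k then f n else 0) = 0) \<longleftrightarrow> f k = 0" for k and f :: "nat \<Rightarrow> 'k W"
      by auto
    have nz': "of_nat (2 * m + 3 choose (m + 2)) \<noteq> (0::'k)" "of_nat (2 * m + 1 choose m) \<noteq> (0::'k)"
      by (simp_all add: zero_less_binomial_iff del: binomial_Suc_Suc of_nat_Suc)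
    have "(\<forall>n. ?d (?D (w3 n)) = 0) \<longleftrightarrow> a1 * c1 + a2 * c2 = 0"
      unfolding dD_w3 all_if eqW using nz'(1) by (simp only: mult_eq_0_iff simp_thms)
    moreover have "(\<forall>n. ?d (?D (w123 n)) = 0) \<longleftrightarrow> b1 * c1 + b2 * c2 = 0"
      unfolding dD_w123 all_if eqW using nz'(2) by (simp only: mult_eq_0_iff simp_thms)
    moreover have "(\<forall>n. ?d (?D (w13 n)) = 0) \<longleftrightarrow>
        of_nat (m + 2) * (c1 * a1) = of_nat (m + 1) * (a2 * b1) \<and>
        of_nat (m + 2) * (c1 * a2) = of_nat (m + 1) * (a2 * b2)"
      unfolding dD_w13 all_if eqW right_minus_eq mult.assoc scale ..
    moreover have "(\<forall>n. ?d (?D (w23 n)) = 0) \<longleftrightarrow>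
        of_nat (m + 2) * (c2 * a1) = of_nat (m + 1) * - (a1 * b1) \<and>
        of_nat (m + 2) * (c2 * a2) = of_nat (m + 1) * - (a1 * b2)"
      unfolding dD_w23 all_if eqW mult.assoc scale_plus ..
    ultimately show ?thesis
      by (simp only: mult.assoc mult_minus_right) blast
  qed
  finally show ?thesis
    unfolding codifferential_def using lin_map_odd_cochain[of m] odd_cochain_parity[of m] by blast
qed

section \<open>Linear automorphisms\<close>

text \<open>With the images of \<open>W1\<close> and \<open>W2\<close> as rows, the composite has
  the matrix of the inner map times that of the outer one.\<close>

lemma sym_map_comp:
  "sym_map p q s t r (sym_map p' q' s' t' r' x) =
    sym_map (p' * p + q' * s) (p' * q + q' * t) (s' * p + t' * s) (s' * q + t' * t) (r * r') x"
proof -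
  let ?G = "sym_map p q s t r" and ?H = "sym_map p' q' s' t' r'"
  let ?K = "sym_map (p' * p + q' * s) (p' * q + q' * t) (s' * p + t' * s) (s' * q + t' * t) (r * r')"
  have "(\<lambda>x. ?G (?H x)) = ?K"
    by (rule lin_map_eq_on_monomials[OF lin_map_comp[OF lin_map_sym_map lin_map_sym_map] lin_map_sym_map];
        rule poly_mapping_eqI)
      (simp_all add: sym_map_monomials lin_map_simps[OF lin_map_sym_map] lookup_add
        power_mult_distrib algebra_simps)
  then show ?thesis by (rule fun_cong)
qed

lemma sym_map_id: "sym_map 1 0 0 1 1 x = x"
proof -
  have "sym_map 1 0 0 1 1 = (\<lambda>x. x)"
    by (rule lin_map_eq_on_monomials[OF lin_map_sym_map])
      (simp_all add: sym_map_monomials lin_mapI)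
  then show ?thesis by (rule fun_cong)
qed

lemma bij_sym_map:
  assumes "p * t - q * s \<noteq> 0" "r \<noteq> 0"
  shows "bij (sym_map p q s t r)"
proof -
  define e where "e = p * t - q * s"
  \<comment> \<open>The inverse matrix, as the adjugate divided by the determinant.\<close>
  let ?H = "sym_map (t / e) (- q / e) (- s / e) (p / e) (1 / r)"
  have e: "e \<noteq> 0" "p * t = e + q * s" using assms(1) by (simp_all add: e_def)
  have eqs: "t / e * p + - q / e * s = 1" "t / e * q + - q / e * t = 0"
    "- s / e * p + p / e * s = 0" "- s / e * q + p / e * t = 1"
    "p * (t / e) + q * (- s / e) = 1" "p * (- q / e) + q * (p / e) = 0"
    "s * (t / e) + t * (- s / e) = 0" "s * (- q / e) + t * (p / e) = 1"
    using e by (simp_all add: divide_simps) (simp_all add: mult.commute)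
  have "sym_map p q s t r (?H x) = x" "?H (sym_map p q s t r x) = x" for x
    unfolding sym_map_comp eqs using assms(2) by (simp_all add: sym_map_id)
  then show ?thesis by (intro o_bij[of ?H]) (simp_all add: fun_eq_iff)
qed

lemma coalg_automorphism_sym_map:
  assumes "p * t - q * s \<noteq> 0" "r \<noteq> 0"
  shows "coalg_automorphism (sym_map p q s t r)"
proof -
  have "homogeneous mpar (mpar I + 0) (sym_map p q s t r (bas I))" for I
  proof -
    have hom: "homogeneous mpar 0 (w3 n)" "homogeneous mpar (Suc 0) (w13 n)"
      "homogeneous mpar (Suc 0) (w23 n)" "homogeneous mpar 2 (w123 n)" for n
      by (cases n; simp add: monomials_Abs_mon homogeneous_def)+
    have add: "homogeneous mpar k (u + v)" "homogeneous mpar k (z \<cdot> u)"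
      if "homogeneous mpar k u" "homogeneous mpar k v" for k z and u v :: "'a S"
      using that by (auto simp: homogeneous_lookup lookup_add)
    show ?thesis
      by (cases I rule: mon_cases)
        (auto simp: sym_map_def intro!: add hom intro: hom)
  qed
  then show ?thesis
    using lin_map_sym_map bij_sym_map[OF assms] coprod_sym_map[of p q s t r]
    by (auto simp: coalg_automorphism_def fun_eq_iff intro!: map_of_parityI)
qed

text \<open>The assumptions are exactly what comparing coefficients demands for
  \<open>sym_map p q s t 1\<close> to intertwine the two coderivations.\<close>

lemma equivalent_odd_cochainI:
  fixes a1 a2 b1 b2 c1 c2 :: "'k::field"
  assumes det: "p * t - q * s \<noteq> 0"
    and a: "a1 = p * a1' + s * a2'" "a2 = q * a1' + t * a2'"
    and b: "(p * t - q * s) * b1 = p * b1' + s * b2'" "(p * t - q * s) * b2 = q * b1' + t * b2'"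
    and c: "c1' = p * c1 + q * c2" "c2' = s * c1 + t * c2"
  shows "equivalent (odd_cochain m (a1, a2) (b1, b2) (c1, c2))
    (odd_cochain m (a1', a2') (b1', b2') (c1', c2'))"
proof -
  let ?G = "sym_map p q s t 1"
  let ?d = "odd_cochain m (a1, a2) (b1, b2) (c1, c2)"
  let ?d' = "odd_cochain m (a1', a2') (b1', b2') (c1', c2')"
  have "(\<lambda>x. ?G (coder ?d' x)) = (\<lambda>x. coder ?d (?G x))"
  proof (rule lin_map_eq_on_monomials[OF lin_map_comp[OF lin_map_sym_map lin_map_coder]
        lin_map_comp[OF lin_map_coder lin_map_sym_map]])
    fix n
    note eqs = coder_odd_cochain sym_map_monomials lin_map_simps[OF lin_map_sym_map]
      lin_map_simps[OF lin_map_coder] lookup_add lookup_minus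
    show "?G (coder ?d' (w3 n)) = coder ?d (?G (w3 n))"
      by (rule poly_mapping_eqI) (simp add: eqs a algebra_simps)
    show "?G (coder ?d' (w13 n)) = coder ?d (?G (w13 n))"
      by (rule poly_mapping_eqI) (simp add: eqs a c algebra_simps)
    show "?G (coder ?d' (w23 n)) = coder ?d (?G (w23 n))"
      by (rule poly_mapping_eqI) (simp add: eqs a c algebra_simps)
    let ?x = "of_nat (n choose m) :: 'k" and ?y = "of_nat (n choose (m + 1)) :: 'k"
    \<comment> \<open>On \<open>w123\<close> the b and c parts mix. The identity
      \<open>p * c2' - s * c1' = (p * t - q * s) * c2\<close> lets the determinant be factored out
      of both; the next equation is analogous.\<close>
    have 1: "(?x * b1' - ?y * c2') * p + (?x * b2' + ?y * c1') * s = (p * t - q * s) * (?x * b1 - ?y * c2)"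
    proof -
      have "(?x * b1' - ?y * c2') * p + (?x * b2' + ?y * c1') * s =
        ?x * ((p * t - q * s) * b1) - ?y * (p * c2' - s * c1')"
        unfolding b by (simp add: algebra_simps)
      then show ?thesis by (simp add: c algebra_simps)
    qed
    have 2: "(?x * b1' - ?y * c2') * q + (?x * b2' + ?y * c1') * t = (p * t - q * s) * (?x * b2 + ?y * c1)"
    proof -
      have "(?x * b1' - ?y * c2') * q + (?x * b2' + ?y * c1') * t =
        ?x * ((p * t - q * s) * b2) - ?y * (q * c2' - t * c1')"
        unfolding b by (simp add: algebra_simps)
      then show ?thesis by (simp add: c algebra_simps)
    qed
    have "?G (coder ?d' (w123 n)) =
      ((?x * b1' - ?y * c2') * p + (?x * b2' + ?y * c1') * s) \<cdot> w13 (n - m) +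
      ((?x * b1' - ?y * c2') * q + (?x * b2' + ?y * c1') * t) \<cdot> w23 (n - m)"
      by (rule poly_mapping_eqI) (simp add: eqs algebra_simps)
    then show "?G (coder ?d' (w123 n)) = coder ?d (?G (w123 n))"
      unfolding 1 2 by (simp add: eqs scal.scale_right_distrib)
  qed
  then have "?G (coder ?d' x) = coder ?d (?G x)" for x by (rule fun_cong)
  moreover have G: "coalg_automorphism ?G"
    using det by (intro coalg_automorphism_sym_map) auto
  moreover have "inj ?G" using G by (simp add: coalg_automorphism_def bij_def)
  ultimately have "inv ?G (coder ?d (?G x)) = coder ?d' x" for x
    by (metis inv_f_f)
  then have "coder ?d' = inv ?G \<circ> coder ?d \<circ> ?G" by (simp add: fun_eq_iff)
  then show ?thesis using G by (auto simp: equivalent_def)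
qed

section \<open>Equivalences act through their linear part\<close>

lemma lookup_lin_map:
  assumes "lin_map f"
  shows "Poly_Mapping.lookup (f p) y =
    (\<Sum>x\<in>Poly_Mapping.keys p. Poly_Mapping.lookup p x * Poly_Mapping.lookup (f (bas x)) y)"
  by (subst lin_map_expand[OF assms]) (simp add: lookup_sum)

section \<open>Reading coefficients off the coproduct\<close>

lemma lookup_coprod_bas_eq_0:
  assumes "mdeg x + mdeg y \<noteq> mdeg I"
  shows "Poly_Mapping.lookup (coprod (bas I)) (x, y) = 0"
proof -
  note eqs = coprod_monomials lookup_sum lookup_scal lookup_add lookup_minus lookup_tensor lookup_monomials mdeg_def
  show ?thesis
  proof (cases I rule: mon_cases)
    case (1 n)
    then have I: "bas I = w3 (Suc n)" by (simp add: monomials_Abs_mon)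
    show ?thesis
      using assms unfolding I eqs by (intro sum.neutral ballI) (auto simp: 1)
  next
    case (2 n)
    then have I: "bas I = w13 n" by (simp add: monomials_Abs_mon)
    show ?thesis
      using assms unfolding I eqs by (intro sum.neutral ballI) (auto simp: 2)
  next
    case (3 n)
    then have I: "bas I = w23 n" by (simp add: monomials_Abs_mon)
    show ?thesis
      using assms unfolding I eqs by (intro sum.neutral ballI) (auto simp: 3)
  next
    case (4 n)
    then have I: "bas I = w123 n" by (simp add: monomials_Abs_mon)
    show ?thesis
      using assms unfolding I eqs by (intro sum.neutral ballI) (auto simp: 4)
  qed
qed

text \<open>Splitting off a single even generator is sign-free and can be done in
  \<open>n + 1\<close> ways, and \<open>J\<close> is the only monomial from which this pair
  arises.\<close>

lemma lookup_coprod_W3: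
  assumes x: "Rep_mon x = (0, 0, 1)" and y: "Rep_mon y = (i, j, n)" and J: "Rep_mon J = (i, j, n + 1)"
  shows "Poly_Mapping.lookup (coprod p) (x, y) = of_nat (n + 1) * Poly_Mapping.lookup p J"
proof -
  \<comment> \<open>The left tensor factor is the even generator itself, so only the summand with
    \<open>a = 1\<close> can contribute.\<close>
  have at_1: "(\<Sum>a\<le>k. f a) = (if 0 < k then f 1 else 0)" if "\<And>a. a \<noteq> 1 \<Longrightarrow> f a = 0"
    for k and f :: "nat \<Rightarrow> 'a"
    using sum.mono_neutral_right[of "{..k}" "{..k} \<inter> {1}" f] that
    by (cases "0 < k") (auto simp: Suc_le_eq)
  have bas: "Poly_Mapping.lookup (coprod (bas I)) (x, y) = (if I = J then of_nat (n + 1) else 0 :: 'a)"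
    for I
  proof -
    have IJ: "I = J \<longleftrightarrow> Rep_mon I = (i, j, n + 1)"
      using J by (metis Rep_mon_inject)
    note eqs = coprod_monomials lookup_sum lookup_tensor lookup_monomials lookup_add lookup_minus x y
    show ?thesis
    proof (cases I rule: mon_cases)
      case (1 k)
      then have I: "bas I = w3 (Suc k)" by (simp add: monomials_Abs_mon)
      show ?thesis
        unfolding IJ I eqs lookup_scal by (subst at_1) (auto simp: 1)
    next
      case (2 k)
      then have I: "bas I = w13 k" by (simp add: monomials_Abs_mon)
      show ?thesis
        unfolding IJ I eqs lookup_scal by (subst at_1) (auto simp: 2)
    next
      case (3 k)
      then have I: "bas I = w23 k" by (simp add: monomials_Abs_mon)
      show ?thesis
        unfolding IJ I eqs lookup_scal by (subst at_1) (auto simp: 3)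
    next
      case (4 k)
      then have I: "bas I = w123 k" by (simp add: monomials_Abs_mon)
      show ?thesis
        unfolding IJ I eqs lookup_scal by (subst at_1) (auto simp: 4)
    qed
  qed
  have "Poly_Mapping.lookup (coprod p) (x, y) =
      (\<Sum>I\<in>Poly_Mapping.keys p. if I = J then Poly_Mapping.lookup p I * of_nat (n + 1) else 0)"
    unfolding lookup_lin_map[OF lin_map_coprod, of p] bas by (intro sum.cong) auto
  then show ?thesis by (simp add: in_keys_iff)
qed


lemma lookup_coprod_W1_W2:
  "Poly_Mapping.lookup (coprod p) (Abs_mon (1, 0, 0), Abs_mon (0, 1, 0)) =
    Poly_Mapping.lookup p (Abs_mon (1, 1, 0))"
proof -
  let ?x = "Abs_mon (1, 0, 0)" and ?y = "Abs_mon (0, 1, 0)" and ?J = "Abs_mon (1, 1, 0)"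
  have bas: "Poly_Mapping.lookup (coprod (bas I)) (?x, ?y) = (if I = ?J then 1 else 0 :: 'a)" for I
  proof -
    have IJ: "I = ?J \<longleftrightarrow> Rep_mon I = (1, 1, 0)"
      by (metis Rep_Abs_mon(7) Rep_mon_inverse)
    have at_0: "(\<Sum>a\<le>k. f a) = f 0" if "\<And>a. a \<noteq> 0 \<Longrightarrow> f a = 0"
      for k and f :: "nat \<Rightarrow> 'a"
      using sum.mono_neutral_right[of "{..k}" "{0}" f] that by auto
    note eqs = coprod_monomials lookup_sum lookup_tensor lookup_monomials lookup_add lookup_minus
    show ?thesis
    proof (cases I rule: mon_cases)
      case (1 k)
      then have I: "bas I = w3 (Suc k)" by (simp add: monomials_Abs_mon)
      show ?thesis
        unfolding IJ I eqs lookup_scal by (subst at_0) (auto simp: 1)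
    next
      case (2 k)
      then have I: "bas I = w13 k" by (simp add: monomials_Abs_mon)
      show ?thesis
        unfolding IJ I eqs lookup_scal by (subst at_0) (auto simp: 2)
    next
      case (3 k)
      then have I: "bas I = w23 k" by (simp add: monomials_Abs_mon)
      show ?thesis
        unfolding IJ I eqs lookup_scal by (subst at_0) (auto simp: 3)
    next
      case (4 k)
      then have I: "bas I = w123 k" by (simp add: monomials_Abs_mon)
      show ?thesis
        unfolding IJ I eqs lookup_scal by (subst at_0) (auto simp: 4)
    qed
  qed
  have "Poly_Mapping.lookup (coprod p) (?x, ?y) =
      (\<Sum>I\<in>Poly_Mapping.keys p. if I = ?J then Poly_Mapping.lookup p I else 0)"
    unfolding lookup_lin_map[OF lin_map_coprod, of p] bas by (intro sum.cong) auto
  then show ?thesis by (simp add: in_keys_iff)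
qed

text \<open>The reduced coproduct determines all coefficients of degree at least two. Nonvanishing
  of \<open>z\<close> rests on characteristic zero, as \<open>z\<close> may be a positive
  integer.\<close>

lemma exists_coprod_detecting:
  assumes "2 \<le> mdeg J"
  obtains x y and z :: "'k::field_char_0" where "mdeg x + mdeg y = mdeg J" "z \<noteq> 0"
    "\<And>p. Poly_Mapping.lookup (coprod p) (x, y) = z * Poly_Mapping.lookup p J"
proof (cases "\<exists>i j n. Rep_mon J = (i, j, n + 1) \<and> 1 \<le> i + j + n")
  case True
  then obtain i j n where J: "Rep_mon J = (i, j, n + 1)" "1 \<le> i + j + n" by blast
  have "i \<le> 1" "j \<le> 1" using Rep_mon[of J] by (auto simp: J)
  then have y: "Rep_mon (Abs_mon (i, j, n)) = (i, j, n)"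
    using J(2) by (intro Abs_mon_inverse) auto
  show thesis
    by (rule that[of "Abs_mon (0, 0, 1)" "Abs_mon (i, j, n)" "of_nat (n + 1)"])
      (use J y lookup_coprod_W3[of "Abs_mon (0, 0, 1)" "Abs_mon (i, j, n)" i j n J]
        in \<open>simp_all add: mdeg_def del: of_nat_Suc of_nat_add\<close>)
next
  case False
  have no_Suc: "(\<forall>k. n \<noteq> Suc k) \<longleftrightarrow> n = 0" for n by (cases n) auto
  \<comment> \<open>If no even generator can be split off, degree at least two leaves only the
    product of the two odd generators.\<close>
  have J: "J = Abs_mon (1, 1, 0)"
    using assms False by (cases J rule: mon_cases) (auto simp: gr0_conv_Suc Suc_le_eq no_Suc)
  show thesis
    by (rule that[of "Abs_mon (1, 0, 0)" "Abs_mon (0, 1, 0)" 1])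
      (use lookup_coprod_W1_W2 in \<open>simp_all add: J\<close>)
qed

lemma lookup_tensor_map:
  assumes "lin_map f" "lin_map g"
  shows "Poly_Mapping.lookup (tensor_map f g w) (x, y) = (\<Sum>(u, v)\<in>Poly_Mapping.keys w.
    Poly_Mapping.lookup w (u, v) * (Poly_Mapping.lookup (f (bas u)) x * Poly_Mapping.lookup (g (bas v)) y))"
  unfolding lookup_lin_map[OF lin_map_tensor_map, of _ _ w]
  by (intro sum.cong) (auto simp: tensor_bas[symmetric] tensor_map_tensor[OF assms] lookup_tensor)

text \<open>A coalgebra map does not raise the degree: the coproduct is homogeneous and detects all
  coefficients in degree at least two.\<close>

lemma coalg_map_filtered:
  fixes F :: "'k::field_char_0 S \<Rightarrow> 'k S"
  assumes lin: "lin_map F" and coalg: "coprod \<circ> F = tensor_map F F \<circ> coprod"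
    and "mdeg I < mdeg J"
  shows "Poly_Mapping.lookup (F (bas I)) J = 0"
  using assms(3)
proof (induction "mdeg I" arbitrary: I J rule: less_induct)
  case less
  have "2 \<le> mdeg J" using less.prems mdeg_pos[of I] by simp
  then obtain x y and z :: 'k where xy: "mdeg x + mdeg y = mdeg J" and z: "z \<noteq> 0"
    and split: "\<And>p. Poly_Mapping.lookup (coprod p) (x, y) = z * Poly_Mapping.lookup p J"
    by (rule exists_coprod_detecting) blast
  have "z * Poly_Mapping.lookup (F (bas I)) J
      = Poly_Mapping.lookup (tensor_map F F (coprod (bas I))) (x, y)"
    using split coalg by (metis comp_apply)
  also have "\<dots> = 0"
    unfolding lookup_tensor_map[OF lin lin]
  proof (intro sum.neutral ballI, clarify)
    fix u v assume "(u, v) \<in> Poly_Mapping.keys (coprod (bas I :: 'k S))"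
    then have uv: "mdeg u + mdeg v = mdeg I"
      using lookup_coprod_bas_eq_0[of u v I, where 'a = 'k] by (auto simp: in_keys_iff)
    then have "mdeg u < mdeg I" "mdeg v < mdeg I" using mdeg_pos[of u] mdeg_pos[of v] by auto
    \<comment> \<open>The target degrees have the larger sum, so at least one tensor factor would
      have to raise the degree.\<close>
    moreover have "mdeg u < mdeg x \<or> mdeg v < mdeg y" using uv xy less.prems by linarith
    ultimately show "Poly_Mapping.lookup (coprod (bas I)) (u, v) *
        (Poly_Mapping.lookup (F (bas u)) x * Poly_Mapping.lookup (F (bas v)) y) = 0"
      using less.hyps by auto
  qed
  finally show ?case using z by simp
qed

text \<open>The coproduct expresses a coefficient of degree at least two through values on monomials
  of smaller degree, so the degree-preserving part of a coalgebra map is determined by its linear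
  part.\<close>

lemma coalg_maps_same_top_part:
  fixes F H :: "'k::field_char_0 S \<Rightarrow> 'k S"
  assumes F: "lin_map F" "coprod \<circ> F = tensor_map F F \<circ> coprod"
    and H: "lin_map H" "coprod \<circ> H = tensor_map H H \<circ> coprod"
    and linear_part: "\<And>I J. mdeg I = 1 \<Longrightarrow> mdeg J = 1 \<Longrightarrow>
      Poly_Mapping.lookup (F (bas I)) J = Poly_Mapping.lookup (H (bas I)) J"
    and "mdeg J = mdeg I"
  shows "Poly_Mapping.lookup (F (bas I)) J = Poly_Mapping.lookup (H (bas I)) J"
  using assms(6)
proof (induction "mdeg I" arbitrary: I J rule: less_induct)
  case less
  show ?case
  proof (cases "mdeg I = 1")
    case True
    then show ?thesis using less.prems linear_part by simp
  next
    case False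
    then have "2 \<le> mdeg J" using less.prems mdeg_pos[of I] by simp
    then obtain x y and z :: 'k where xy: "mdeg x + mdeg y = mdeg J" and z: "z \<noteq> 0"
      and split: "\<And>p. Poly_Mapping.lookup (coprod p) (x, y) = z * Poly_Mapping.lookup p J"
      by (rule exists_coprod_detecting) blast
    have "z * Poly_Mapping.lookup (F (bas I)) J
        = Poly_Mapping.lookup (tensor_map F F (coprod (bas I))) (x, y)"
      using split F(2) by (metis comp_apply)
    also have "\<dots> = Poly_Mapping.lookup (tensor_map H H (coprod (bas I))) (x, y)"
      unfolding lookup_tensor_map[OF F(1) F(1)] lookup_tensor_map[OF H(1) H(1)]
    proof (intro sum.cong refl, clarify)
      fix u v assume "(u, v) \<in> Poly_Mapping.keys (coprod (bas I :: 'k S))"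
      then have uv: "mdeg u + mdeg v = mdeg I"
        using lookup_coprod_bas_eq_0[of u v I, where 'a = 'k] by (auto simp: in_keys_iff)
      then have small: "mdeg u < mdeg I" "mdeg v < mdeg I"
        using mdeg_pos[of u] mdeg_pos[of v] by auto
      \<comment> \<open>Either some factor would raise the degree, so that both sides vanish, or
        both factors preserve it and the induction hypothesis applies.\<close>
      consider "mdeg u < mdeg x" | "mdeg v < mdeg y" | "mdeg x = mdeg u" "mdeg y = mdeg v"
        using uv xy less.prems by linarith
      then show "Poly_Mapping.lookup (coprod (bas I)) (u, v) *
          (Poly_Mapping.lookup (F (bas u)) x * Poly_Mapping.lookup (F (bas v)) y) =
        Poly_Mapping.lookup (coprod (bas I)) (u, v) *
          (Poly_Mapping.lookup (H (bas u)) x * Poly_Mapping.lookup (H (bas v)) y)"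
        by cases (use small less.hyps coalg_map_filtered[OF F] coalg_map_filtered[OF H] in simp_all)
    qed
    also have "\<dots> = z * Poly_Mapping.lookup (H (bas I)) J"
      using split H(2) by (metis comp_apply)
    finally show ?thesis using z by simp
  qed
qed


lemma bas_eq_monomials:
  "bas (Abs_mon (0, 0, Suc n)) = w3 (Suc n)"
  "bas (Abs_mon (Suc 0, 0, n)) = w13 n"
  "bas (Abs_mon (0, Suc 0, n)) = w23 n"
  "bas (Abs_mon (Suc 0, Suc 0, n)) = w123 n"
  by (simp_all add: monomials_Abs_mon)

text \<open>Parity preservation forbids mixing the even generator with the odd ones, so the linear
  part is a 2 by 2 matrix together with a scalar.\<close>

lemma sym_map_linear_part:
  assumes "map_of_parity mpar mpar 0 G" "mdeg I = 1" "mdeg J = 1"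
  shows "Poly_Mapping.lookup (G (bas I)) J = Poly_Mapping.lookup (sym_map
    (Poly_Mapping.lookup (G (w13 0)) (Abs_mon (1, 0, 0)))
    (Poly_Mapping.lookup (G (w13 0)) (Abs_mon (0, 1, 0)))
    (Poly_Mapping.lookup (G (w23 0)) (Abs_mon (1, 0, 0)))
    (Poly_Mapping.lookup (G (w23 0)) (Abs_mon (0, 1, 0)))
    (Poly_Mapping.lookup (G (w3 1)) (Abs_mon (0, 0, 1))) (bas I)) J"
proof -
  have deg_1: "K = Abs_mon (0, 0, 1) \<or> K = Abs_mon (1, 0, 0) \<or> K = Abs_mon (0, 1, 0)"
    if "mdeg K = 1" for K
    using that by (cases K rule: mon_cases) auto
  have "homogeneous mpar (mpar I + 0) (G (bas I))"
    by (rule map_of_parityD[OF assms(1)])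
  then have even: "Poly_Mapping.lookup (G (bas I)) J = 0" if "mpar J mod 2 \<noteq> mpar I mod 2"
    using that by (simp add: homogeneous_lookup)
  show ?thesis
    using deg_1[OF assms(2)] deg_1[OF assms(3)] even
    by (elim disjE) (simp_all add: bas_eq_monomials sym_map_monomials lookup_add lookup_monomials mpar_def)
qed

section \<open>Transformation law and invariants\<close>

text \<open>Up to terms of lower degree G agrees with the \<open>sym_map\<close> of its linear part.
  On degree \<open>m + 2\<close> these terms are killed by the coderivation of d, and its values
  there lie in degree 1, where G is linear.\<close>

lemma equivalent_odd_cochainE:
  fixes a1 a2 b1 b2 c1 c2 :: "'k::field_char_0"
  assumes "equivalent (odd_cochain m (a1, a2) (b1, b2) (c1, c2))
    (odd_cochain m (a1', a2') (b1', b2') (c1', c2'))"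
  obtains p q s t r where "p * t - q * s \<noteq> 0" "r \<noteq> 0"
    and "r ^ (m + 2) * a1 = p * a1' + s * a2'" "r ^ (m + 2) * a2 = q * a1' + t * a2'"
    and "r ^ m * ((p * t - q * s) * b1) = p * b1' + s * b2'"
      "r ^ m * ((p * t - q * s) * b2) = q * b1' + t * b2'"
    and "c1' = r ^ m * (p * c1 + q * c2)" "c2' = r ^ m * (s * c1 + t * c2)"
proof -
  let ?l = "Poly_Mapping.lookup"
  let ?d = "odd_cochain m (a1, a2) (b1, b2) (c1, c2)"
  let ?d' = "odd_cochain m (a1', a2') (b1', b2') (c1', c2')"
  obtain G where G: "coalg_automorphism G" and eq: "coder ?d' = inv G \<circ> coder ?d \<circ> G"
    using assms by (auto simp: equivalent_def)
  have lin: "lin_map G" and bij: "bij G" and par: "map_of_parity mpar mpar 0 G"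
    and coalg: "coprod \<circ> G = tensor_map G G \<circ> coprod"
    using G by (simp_all add: coalg_automorphism_def)
  have inj: "inj G" using bij by (rule bij_is_inj)
  have eq: "G (coder ?d' x) = coder ?d (G x)" for x
    using bij unfolding eq by (simp add: surj_f_inv_f[OF bij_is_surj])
  define p q s t r where "p = ?l (G (w13 0)) (Abs_mon (1, 0, 0))"
    and "q = ?l (G (w13 0)) (Abs_mon (0, 1, 0))" and "s = ?l (G (w23 0)) (Abs_mon (1, 0, 0))"
    and "t = ?l (G (w23 0)) (Abs_mon (0, 1, 0))" and "r = ?l (G (w3 1)) (Abs_mon (0, 0, 1))"
  let ?H = "sym_map p q s t r"
  have coalg_H: "coprod \<circ> ?H = tensor_map ?H ?H \<circ> coprod"
    by (simp add: fun_eq_iff coprod_sym_map)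
  have linear_part: "?l (G (bas I)) J = ?l (?H (bas I)) J" if "mdeg I = 1" "mdeg J = 1" for I J
    unfolding p_def q_def s_def t_def r_def using par that by (rule sym_map_linear_part)
  have top: "?l (G (bas I)) J = ?l (?H (bas I)) J" if "mdeg I \<le> mdeg J" for I J
  proof (cases "mdeg I = mdeg J")
    case True
    then show ?thesis
      using coalg_maps_same_top_part[OF lin coalg lin_map_sym_map coalg_H linear_part] by simp
  next
    case False
    then show ?thesis
      using that coalg_map_filtered[OF lin coalg] coalg_map_filtered[OF lin_map_sym_map coalg_H]
      by simp
  qed
  \<comment> \<open>No monomial has degree below 1, so in degree 1 there are no correction
    terms.\<close>
  have GW: "G (bas I) = ?H (bas I)" if "mdeg I = 1" for I
    using that mdeg_pos by (intro poly_mapping_eqI top) (simp add: Suc_le_eq)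
  have GW: "G (w13 0) = p \<cdot> w13 0 + q \<cdot> w23 0" "G (w23 0) = s \<cdot> w13 0 + t \<cdot> w23 0"
    "G (w3 1) = r \<cdot> w3 1"
    using GW[of "Abs_mon (1, 0, 0)"] GW[of "Abs_mon (0, 1, 0)"] GW[of "Abs_mon (0, 0, 1)"]
      sym_map_monomials[of p q s t r 0] sym_map_monomials(1)[of p q s t r 1]
    by (simp_all add: monomials_Abs_mon)
  have low: "coder ?d (bas I) = 0" if "mdeg I < m + 2" for I
    using that
    by (cases I rule: mon_cases) (simp_all add: bas_eq_monomials coder_odd_cochain binomial_eq_0
        del: binomial_Suc_Suc)
  have D: "coder ?d (G (bas I)) = coder ?d (?H (bas I))" if "mdeg I = m + 2" for I
  proof -
    have "coder ?d (G (bas I) - ?H (bas I)) = 0"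
      unfolding lin_map_expand[OF lin_map_coder, of _ "G (bas I) - ?H (bas I)"]
    proof (intro sum.neutral ballI)
      fix J assume "J \<in> Poly_Mapping.keys (G (bas I) - ?H (bas I))"
      then have "\<not> mdeg I \<le> mdeg J" using top[of I J] by (auto simp: in_keys_iff lookup_minus)
      then have "mdeg J < m + 2" using that by simp
      then show "?l (G (bas I) - ?H (bas I)) J \<cdot> coder ?d (bas J) = 0"
        by (simp add: low)
    qed
    then show ?thesis by (simp add: lin_map_simps[OF lin_map_coder])
  qed
  note eqs = coder_odd_cochain sym_map_monomials lin_map_simps[OF lin] lin_map_simps[OF lin_map_coder]
    GW lookup_add lookup_minus lookup_monomials binomial_eq_0
  have a: "G (coder ?d' (w3 (m + 2))) = coder ?d (?H (w3 (m + 2)))"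
    using D[of "Abs_mon (0, 0, m + 2)"] by (simp add: eq monomials_Abs_mon)
  have b: "G (coder ?d' (w123 m)) = coder ?d (?H (w123 m))"
    using D[of "Abs_mon (1, 1, m)"] by (simp add: eq monomials_Abs_mon)
  have c: "G (coder ?d' (w13 (m + 1))) = coder ?d (?H (w13 (m + 1)))"
      "G (coder ?d' (w23 (m + 1))) = coder ?d (?H (w23 (m + 1)))"
    using D[of "Abs_mon (1, 0, m + 1)"] D[of "Abs_mon (0, 1, m + 1)"]
    by (simp_all add: eq monomials_Abs_mon)
  have inj_0: "x = 0" if "G x = 0" for x
    using that inj by (metis injD lin_map_0[OF lin])
  have r: "r \<noteq> 0"
  proof
    assume "r = 0"
    then have "G (w3 1) = 0" using GW(3) by simp
    then have "w3 1 = (0 :: 'k S)" by (rule inj_0)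
    then show False
      using lookup_monomials(1)[of 1 "Abs_mon (0, 0, 1)", where 'a = 'k] by simp
  qed
  have coords: "x = 0 \<and> y = 0" if "x \<cdot> w13 0 + y \<cdot> w23 0 = (0 :: 'k S)" for x y
  proof -
    have "?l (x \<cdot> w13 0 + y \<cdot> w23 0) (Abs_mon (1, 0, 0)) = 0"
      "?l (x \<cdot> w13 0 + y \<cdot> w23 0) (Abs_mon (0, 1, 0)) = 0"
      unfolding that by simp_all
    then show ?thesis by (simp add: lookup_add lookup_monomials)
  qed
  have G_W: "G (x \<cdot> w13 0 + y \<cdot> w23 0) = (x * p + y * s) \<cdot> w13 0 + (x * q + y * t) \<cdot> w23 0" for x y
    by (rule poly_mapping_eqI) (simp add: lin_map_simps[OF lin] GW lookup_add algebra_simps)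
  have det: "p * t - q * s \<noteq> 0"
  proof
    \<comment> \<open>A singular matrix sends both \<open>t w1 - q w2\<close> and
      \<open>s w1 - p w2\<close> to 0. Injectivity then gives \<open>p = q = 0\<close>, so G would
      kill the first generator.\<close>
    assume "p * t - q * s = 0"
    then have 1: "G (t \<cdot> w13 0 + (- q) \<cdot> w23 0) = 0" and 2: "G (s \<cdot> w13 0 + (- p) \<cdot> w23 0) = 0"
      unfolding G_W by (simp_all add: mult.commute)
    have "q = 0" using coords[OF inj_0[OF 1]] by simp
    moreover have "p = 0" using coords[OF inj_0[OF 2]] by simp
    ultimately have "G (1 \<cdot> w13 0 + 0 \<cdot> w23 0) = 0" by (simp add: GW)
    from coords[OF inj_0[OF this]] show False by simp
  qed
  have lookups: "?l x (Abs_mon (1, 0, 0)) = ?l y (Abs_mon (1, 0, 0))"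
    "?l x (Abs_mon (0, 1, 0)) = ?l y (Abs_mon (0, 1, 0))"
    "?l x (Abs_mon (0, 0, 1)) = ?l y (Abs_mon (0, 0, 1))" if "x = y" for x y :: "'k S"
    using that by simp_all
  show thesis
  proof (rule that[OF det r])
    show "r ^ (m + 2) * a1 = p * a1' + s * a2'" "r ^ (m + 2) * a2 = q * a1' + t * a2'"
      using lookups(1,2)[OF a] by (simp_all add: eqs algebra_simps)
    show "r ^ m * ((p * t - q * s) * b1) = p * b1' + s * b2'"
      "r ^ m * ((p * t - q * s) * b2) = q * b1' + t * b2'"
      using lookups(1,2)[OF b] by (simp_all add: eqs algebra_simps)
    \<comment> \<open>Both values lie on the even generator, which G scales by \<open>r\<close>; one
      power of \<open>r\<close> therefore cancels.\<close>
    have "r * c1' = r * (r ^ m * (p * c1 + q * c2))" "r * c2' = r * (r ^ m * (s * c1 + t * c2))"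
      using lookups(3)[OF c(1)] lookups(3)[OF c(2)] GW(3)
      by (simp_all add: eqs algebra_simps)
    then show "c1' = r ^ m * (p * c1 + q * c2)" "c2' = r ^ m * (s * c1 + t * c2)"
      using r by simp_all
  qed
qed

text \<open>The first two claims hold because invertible matrices preserve vanishing. For the third,
  the vector (c2, -c1) obeys the same transformation law as b, hence so does b - l (c2,
  -c1).\<close>

lemma equivalent_odd_cochain_invariants:
  fixes a1 a2 b1 b2 c1 c2 :: "'k::field_char_0"
  assumes "equivalent (odd_cochain m (a1, a2) (b1, b2) (c1, c2))
    (odd_cochain m (a1', a2') (b1', b2') (c1', c2'))"
  shows "a1 = 0 \<and> a2 = 0 \<longleftrightarrow> a1' = 0 \<and> a2' = 0"
    and "c1 = 0 \<and> c2 = 0 \<longleftrightarrow> c1' = 0 \<and> c2' = 0"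
    and "b1 = l * c2 \<and> b2 = - (l * c1) \<longleftrightarrow> b1' = l * c2' \<and> b2' = - (l * c1')"
proof -
  obtain p q s t r where det: "p * t - q * s \<noteq> 0" and r: "r \<noteq> 0"
    and a: "r ^ (m + 2) * a1 = p * a1' + s * a2'" "r ^ (m + 2) * a2 = q * a1' + t * a2'"
    and b: "r ^ m * ((p * t - q * s) * b1) = p * b1' + s * b2'"
      "r ^ m * ((p * t - q * s) * b2) = q * b1' + t * b2'"
    and c: "c1' = r ^ m * (p * c1 + q * c2)" "c2' = r ^ m * (s * c1 + t * c2)"
    using assms by (rule equivalent_odd_cochainE) blast
  have cramer: "x = 0 \<and> y = 0 \<longleftrightarrow> p * x + s * y = 0 \<and> q * x + t * y = 0" 
    "x = 0 \<and> y = 0 \<longleftrightarrow> p * x + q * y = 0 \<and> s * x + t * y = 0" for x y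
  proof -
    have "(p * t - q * s) * x = t * (p * x + s * y) - s * (q * x + t * y)"
      "(p * t - q * s) * y = p * (q * x + t * y) - q * (p * x + s * y)"
      "(p * t - q * s) * x = t * (p * x + q * y) - q * (s * x + t * y)"
      "(p * t - q * s) * y = p * (s * x + t * y) - s * (p * x + q * y)"
      by (simp_all add: algebra_simps)
    then show "x = 0 \<and> y = 0 \<longleftrightarrow> p * x + s * y = 0 \<and> q * x + t * y = 0"
      "x = 0 \<and> y = 0 \<longleftrightarrow> p * x + q * y = 0 \<and> s * x + t * y = 0"
      using det by auto
  qed
  show "a1 = 0 \<and> a2 = 0 \<longleftrightarrow> a1' = 0 \<and> a2' = 0"
    unfolding cramer(1)[of a1' a2'] a[symmetric] using r by simp
  show "c1 = 0 \<and> c2 = 0 \<longleftrightarrow> c1' = 0 \<and> c2' = 0"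
    unfolding cramer(2)[of c1 c2] c using r by simp
  let ?x = "b1' - l * c2'" and ?y = "b2' + l * c1'"
  have "p * ?x + s * ?y = (p * b1' + s * b2') - l * (p * c2' - s * c1')"
    by (simp add: algebra_simps)
  also have "\<dots> = r ^ m * (p * t - q * s) * (b1 - l * c2)"
    unfolding b[symmetric] c by (simp add: algebra_simps)
  finally have 1: "p * ?x + s * ?y = r ^ m * (p * t - q * s) * (b1 - l * c2)" .
  have "q * ?x + t * ?y = (q * b1' + t * b2') - l * (q * c2' - t * c1')"
    by (simp add: algebra_simps)
  also have "\<dots> = r ^ m * (p * t - q * s) * (b2 + l * c1)"
    unfolding b[symmetric] c by (simp add: algebra_simps)
  finally have 2: "q * ?x + t * ?y = r ^ m * (p * t - q * s) * (b2 + l * c1)" .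
  have "?x = 0 \<and> ?y = 0 \<longleftrightarrow> b1 - l * c2 = 0 \<and> b2 + l * c1 = 0"
    unfolding cramer(1)[of ?x ?y] 1 2 using r det by simp
  then show "b1 = l * c2 \<and> b2 = - (l * c1) \<longleftrightarrow> b1' = l * c2' \<and> b2' = - (l * c1')"
    by (auto simp: eq_neg_iff_add_eq_0)
qed


section \<open>Normal forms\<close>

text \<open>The factorials are the factors I! built into the cochains
  \<open>\<phi> I j\<close>.\<close>

lemma normal_forms_eq_odd_cochain:
  "d_inf m = odd_cochain m (0, 0) (fact m, 0) (0, 0)"
  "d_star m = odd_cochain m (fact (m + 2), 0) (0, 0) (0, 0)"
  "d_lam m l = odd_cochain m (0, 0) (l * fact m, 0) (0, fact (m + 1))"
  "d_sharp m = odd_cochain m (fact (m + 2), 0) (- (of_nat (m + 2) * fact m), 0) (0, fact (m + 1))"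
proof -
  have lin: "lin_map (\<phi> I j)" for I j
    unfolding \<phi>_def by (rule lin_map_lin_ext)
  have l1: "lin_map (\<lambda>x. f x + c \<cdot> g x)" if "lin_map f" "lin_map g" for c and f g :: "'k::field S \<Rightarrow> 'k W"
    by (rule lin_mapI) (simp_all add: lin_map_simps[OF that(1)] lin_map_simps[OF that(2)]
        scal.scale_right_distrib mult.commute)
  have l2: "lin_map (\<lambda>x. f x + h x - c \<cdot> g x)" if "lin_map f" "lin_map g" "lin_map h"
    for c and f g h :: "'k::field S \<Rightarrow> 'k W"
    by (rule lin_mapI) (simp_all add: lin_map_simps[OF that(1)] lin_map_simps[OF that(2)]
        lin_map_simps[OF that(3)] scal.scale_right_distrib scal.scale_right_diff_distrib mult.commute)
  note eqs = d_inf_def d_star_def d_lam_def d_sharp_def \<phi>_def lin_ext_monomials odd_cochain_monomials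
  show "d_inf m = odd_cochain m (0, 0) (fact m, 0) (0, 0)"
    by (rule lin_map_eq_on_monomials[OF _ lin_map_odd_cochain])
      (auto simp: eqs lin[unfolded \<phi>_def])
  show "d_star m = odd_cochain m (fact (m + 2), 0) (0, 0) (0, 0)"
    by (rule lin_map_eq_on_monomials[OF _ lin_map_odd_cochain])
      (auto simp: eqs lin[unfolded \<phi>_def])
  show "d_lam m l = odd_cochain m (0, 0) (l * fact m, 0) (0, fact (m + 1))"
    unfolding d_lam_def
    by (rule lin_map_eq_on_monomials[OF l1[OF lin lin] lin_map_odd_cochain]) (auto simp: eqs)
  show "d_sharp m = odd_cochain m (fact (m + 2), 0) (- (of_nat (m + 2) * fact m), 0) (0, fact (m + 1))"
    unfolding d_sharp_def
    by (rule lin_map_eq_on_monomials[OF l2[OF lin lin lin] lin_map_odd_cochain]) (auto simp: eqs)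
qed

lemma odd_cochain_eq_iff:
  "odd_cochain m (a1, a2) (b1, b2) (c1, c2) = odd_cochain m (a1', a2') (b1', b2') (c1', c2') \<longleftrightarrow>
    a1 = a1' \<and> a2 = a2' \<and> b1 = b1' \<and> b2 = b2' \<and> c1 = c1' \<and> c2 = c2'"
proof
  let ?d = "odd_cochain m (a1, a2) (b1, b2) (c1, c2)"
  let ?d' = "odd_cochain m (a1', a2') (b1', b2') (c1', c2')" and ?l = "Poly_Mapping.lookup"
  assume "?d = ?d'"
  then have "?l (?d x) j = ?l (?d' x) j" for x j by simp
  from this[of "w3 (m + 2)" W1] this[of "w3 (m + 2)" W2] this[of "w123 m" W1] this[of "w123 m" W2]
    this[of "w13 (m + 1)" W3] this[of "w23 (m + 1)" W3]
  show "a1 = a1' \<and> a2 = a2' \<and> b1 = b1' \<and> b2 = b2' \<and> c1 = c1' \<and> c2 = c2'"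
    by (simp add: odd_cochain_monomials lookup_add lookup_single)
qed simp

lemma odd_cochain_eq_0_iff:
  fixes a1 :: "'k::field"
  shows "odd_cochain m (a1, a2) (b1, b2) (c1, c2) = (\<lambda>_. 0) \<longleftrightarrow>
    a1 = 0 \<and> a2 = 0 \<and> b1 = 0 \<and> b2 = 0 \<and> c1 = 0 \<and> c2 = 0"
proof -
  have "odd_cochain m (0, 0) (0, 0) (0, 0 :: 'k) = (\<lambda>_. 0)"
    by (rule lin_map_eq_on_monomials[OF lin_map_odd_cochain])
      (auto simp: odd_cochain_monomials intro!: lin_mapI)
  then show ?thesis
    using odd_cochain_eq_iff[of m a1 a2 b1 b2 c1 c2 0 0 0 0 0 0] by simp
qed

section \<open>Reduction of a codifferential to normal form\<close>

text \<open>Serves to complete a given nonzero column to a matrix of prescribed determinant.\<close>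

lemma exists_dual_pair:
  fixes x y k :: "'k::field"
  assumes "x \<noteq> 0 \<or> y \<noteq> 0"
  obtains s t where "s * x + t * y = k"
proof (cases "x = 0")
  case True
  then show thesis using assms that[of 0 "k / y"] by simp
next
  case False
  then show thesis using that[of "k / x" 0] by simp
qed

text \<open>In the plane, the vectors orthogonal to a nonzero (x, y) form the line through (y,
  -x).\<close>

lemma orthogonal_pair:
  fixes x y u v :: "'k::field"
  assumes "u * x + v * y = 0" "x \<noteq> 0 \<or> y \<noteq> 0"
  obtains l where "u = l * y" "v = - (l * x)"
proof (cases "x = 0")
  case True
  then show thesis using assms that[of "u / y"] by simp
next
  case False
  have "u * x = - (v * y)" using assms(1) by (simp add: eq_neg_iff_add_eq_0)
  then show thesis using False by (intro that[of "- v / x"]) (simp_all add: field_simps)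
qed

lemma codifferential_equivalent_to_normal_form:
  fixes d :: "'k::field_char_0 S \<Rightarrow> 'k W"
  assumes d: "codifferential d" "d \<in> L (m + 2)" "d \<noteq> (\<lambda>_. 0)"
  shows "\<exists>e\<in>normal_forms m. equivalent d e"
proof -
  have "map_of_parity mpar gpar 1 d" using d(1) by (simp add: codifferential_def)
  then obtain a1 a2 b1 b2 c1 c2 where eq: "d = odd_cochain m (a1, a2) (b1, b2) (c1, c2)"
    using d(2) by (blast elim: odd_element_eq_odd_cochain)
  have ac: "a1 * c1 + a2 * c2 = 0" and bc: "b1 * c1 + b2 * c2 = 0"
    and c1: "of_nat (m + 2) * c1 * a1 = of_nat (m + 1) * a2 * b1"
      "of_nat (m + 2) * c1 * a2 = of_nat (m + 1) * a2 * b2"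
    and c2: "of_nat (m + 2) * c2 * a1 = - (of_nat (m + 1) * a1 * b1)"
      "of_nat (m + 2) * c2 * a2 = - (of_nat (m + 1) * a1 * b2)"
    using d(1) unfolding eq codifferential_odd_cochain_iff by blast+
  have nz: "of_nat (m + 1) \<noteq> (0::'k)" "of_nat (m + 2) \<noteq> (0::'k)" "fact m \<noteq> (0::'k)"
    "fact (m + 1) \<noteq> (0::'k)" "fact (m + 2) \<noteq> (0::'k)"
    by (simp_all del: of_nat_Suc of_nat_add fact_Suc)
  show ?thesis
  proof (cases "c1 = 0 \<and> c2 = 0")
    case c0: True
    show ?thesis
    proof (cases "a1 = 0 \<and> a2 = 0")
      case a0: True
      have "b1 \<noteq> 0 \<or> b2 \<noteq> 0"
      proof (rule ccontr)
        assume "\<not> (b1 \<noteq> 0 \<or> b2 \<noteq> 0)"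
        then have "d = (\<lambda>_. 0)"
          using a0 c0 by (simp add: eq odd_cochain_eq_0_iff)
        then show False using d(3) by simp
      qed
      \<comment> \<open>With b as first column and determinant m!, the law for b is solved by b' =
        (m!, 0), the coordinates of \<open>d_inf\<close>.\<close>
      then obtain s t where st: "s * (- b2) + t * b1 = fact m"
        using exists_dual_pair[of "- b2" b1 "fact m"] by auto
      then have det: "b1 * t - b2 * s = fact m" by (simp add: algebra_simps)
      have "equivalent d (d_inf m)"
        unfolding eq normal_forms_eq_odd_cochain
        by (rule equivalent_odd_cochainI[of b1 t b2 s]) (simp_all add: det a0 c0)
      then show ?thesis by (auto simp: normal_forms_def)
    next
      case a0: False
      \<comment> \<open>For c = 0 the quadratic relations say that every product of a coordinate of
        a with one of b vanishes.\<close>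
      have b0: "b1 = 0 \<and> b2 = 0" using c1 c2 c0 a0 nz(1) by (auto simp del: of_nat_Suc of_nat_add)
      \<comment> \<open>The first column is a rescaled so that a' = ((m+2)!, 0). As b and c vanish,
        any nonzero determinant would serve; 1 is chosen.\<close>
      define p q where "p = a1 / fact (m + 2)" and "q = a2 / fact (m + 2)"
      have pq: "a1 = p * fact (m + 2)" "a2 = q * fact (m + 2)"
        using nz(5) by (simp_all add: p_def q_def del: fact_Suc)
      then have "p \<noteq> 0 \<or> q \<noteq> 0" using a0 by auto
      then obtain s t where "s * (- q) + t * p = 1"
        using exists_dual_pair[of "- q" p 1] by auto
      then have det: "p * t - q * s = 1" by (simp add: algebra_simps)
      have "equivalent d (d_star m)"
        unfolding eq normal_forms_eq_odd_cochain
        by (rule equivalent_odd_cochainI[of p t q s]) (simp_all add: det b0 c0 pq del: fact_Suc)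
      then show ?thesis by (auto simp: normal_forms_def)
    qed
  next
    case False
    then have c0: "c1 \<noteq> 0 \<or> c2 \<noteq> 0" by blast
    \<comment> \<open>The second column is chosen to make c2' equal to (m+1)!. The first will be a
      multiple of (c2, -c1), which makes c1' vanish.\<close>
    obtain s t where st: "s * c1 + t * c2 = fact (m + 1)" by (rule exists_dual_pair[OF c0])
    obtain \<alpha> where \<alpha>: "a1 = \<alpha> * c2" "a2 = - (\<alpha> * c1)" by (rule orthogonal_pair[OF ac c0])
    obtain \<beta> where \<beta>: "b1 = \<beta> * c2" "b2 = - (\<beta> * c1)" by (rule orthogonal_pair[OF bc c0])
    show ?thesis
    proof (cases "\<alpha> = 0")
      case True
      have det: "c2 * t - - c1 * s = fact (m + 1)" using st by (simp add: algebra_simps)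
      \<comment> \<open>The determinant (m+1)! turns b = \<beta> (c2, -c1) into b' = ((m+1)!
        \<beta>, 0), and the parameter is this entry divided by m!.\<close>
      have "equivalent d (d_lam m (fact (m + 1) * \<beta> / fact m))"
        unfolding eq normal_forms_eq_odd_cochain
        by (rule equivalent_odd_cochainI[of c2 t "- c1" s])
          (simp_all only: det, use nz st in \<open>simp_all add: True \<alpha> \<beta> del: fact_Suc\<close>)
      then show ?thesis by (auto simp: normal_forms_def)
    next
      case \<alpha>0: False
      \<comment> \<open>Scaling the first column by \<kappa> leaves c1' = 0 intact and normalises a'
        to ((m+2)!, 0).\<close>
      define \<kappa> where "\<kappa> = \<alpha> / fact (m + 2)"
      have \<kappa>: "\<alpha> = \<kappa> * fact (m + 2)" using nz(5) by (simp add: \<kappa>_def del: fact_Suc)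
      then have \<kappa>0: "\<kappa> \<noteq> 0" using \<alpha>0 by auto
      \<comment> \<open>Since a is nonzero, a quadratic relation at a nonzero coordinate of c
        determines \<beta>; this is where the coefficient -(m+2) of \<open>d_sharp\<close> comes
        from.\<close>
      have "of_nat (m + 2) + of_nat (m + 1) * \<beta> = (0::'k)"
      proof (cases "c1 = 0")
        case True
        then have "\<alpha> * c2 * c2 * (of_nat (m + 2) + of_nat (m + 1) * \<beta>) = 0"
          using c2(1) \<alpha> \<beta> by (simp add: algebra_simps)
        then show ?thesis using True c0 \<alpha>0 by (simp del: of_nat_Suc of_nat_add)
      next
        case False
        have "\<alpha> * c1 * c1 * (of_nat (m + 2) + of_nat (m + 1) * \<beta>) =
            of_nat (m + 1) * a2 * b2 - of_nat (m + 2) * c1 * a2"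
          unfolding \<alpha> \<beta> by (simp add: algebra_simps)
        also have "\<dots> = 0" unfolding c1(2) by simp
        finally have "\<alpha> * c1 * c1 * (of_nat (m + 2) + of_nat (m + 1) * \<beta>) = 0" .
        then show ?thesis using False \<alpha>0 by (simp del: of_nat_Suc of_nat_add)
      qed
      moreover have "fact (m + 1) * \<beta> + of_nat (m + 2) * fact m =
          fact m * (of_nat (m + 2) + of_nat (m + 1) * \<beta>)"
        by (simp add: algebra_simps)
      ultimately have \<beta>': "fact (m + 1) * \<beta> = - (of_nat (m + 2) * fact m)"
        by (simp only: eq_neg_iff_add_eq_0 mult_zero_right)
      have det: "\<kappa> * c2 * t - - (\<kappa> * c1) * s = \<kappa> * fact (m + 1)"
        unfolding st[symmetric] by (simp add: algebra_simps)
      have "equivalent d (d_sharp m)"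
        unfolding eq normal_forms_eq_odd_cochain
      proof (rule equivalent_odd_cochainI[of "\<kappa> * c2" t "- (\<kappa> * c1)" s])
        show "\<kappa> * c2 * t - - (\<kappa> * c1) * s \<noteq> 0"
          unfolding det using \<kappa>0 nz by (simp del: fact_Suc)
        show "(\<kappa> * c2 * t - - (\<kappa> * c1) * s) * b1 = \<kappa> * c2 * - (of_nat (m + 2) * fact m) + s * 0"
          unfolding det \<beta>'[symmetric] \<beta> by (simp add: algebra_simps del: fact_Suc)
        show "(\<kappa> * c2 * t - - (\<kappa> * c1) * s) * b2 = - (\<kappa> * c1) * - (of_nat (m + 2) * fact m) + t * 0"
          unfolding det \<beta>'[symmetric] \<beta> by (simp add: algebra_simps del: fact_Suc)
      qed (use \<alpha> \<kappa> st in \<open>simp_all add: algebra_simps del: fact_Suc\<close>)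
      then show ?thesis by (auto simp: normal_forms_def)
    qed
  qed
qed

section \<open>Uniqueness of the normal form\<close>

text \<open>Whether a and c vanish decides the type of the normal form, and within the family
  \<open>d_lam\<close> the factor between b and (c2, -c1) recovers the parameter.\<close>

lemma normal_form_unique:
  fixes d :: "'k::field_char_0 S \<Rightarrow> 'k W"
  assumes d: "d \<in> L (m + 2)" "map_of_parity mpar gpar 1 d"
    and e: "e \<in> normal_forms m" "equivalent d e" and e': "e' \<in> normal_forms m" "equivalent d e'"
  shows "e = e'"
proof -
  obtain a1 a2 b1 b2 c1 c2 where eq: "d = odd_cochain m (a1, a2) (b1, b2) (c1, c2)"
    using d by (rule odd_element_eq_odd_cochain)
  have inv: "(if a1 = 0 \<and> a2 = 0 then if c1 = 0 \<and> c2 = 0 then f = d_inf m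
        else \<exists>l. f = d_lam m l \<and> b1 = l / of_nat (m + 1) * c2 \<and> b2 = - (l / of_nat (m + 1) * c1)
      else if c1 = 0 \<and> c2 = 0 then f = d_star m else f = d_sharp m)"
    if "f \<in> normal_forms m" "equivalent d f" for f
  proof -
    note fact_Suc [simp del] of_nat_Suc [simp del] of_nat_add [simp del]
    note that(1)[unfolded normal_forms_def]
    then consider "f = d_inf m" | "f = d_star m" | "f = d_sharp m" | l where "f = d_lam m l"
      by auto
    then show ?thesis
    proof cases
      case 1
      then show ?thesis
        using equivalent_odd_cochain_invariants(1,2)[OF that(2)[unfolded 1 eq normal_forms_eq_odd_cochain]]
        by simp
    next
      case 2
      then show ?thesis
        using equivalent_odd_cochain_invariants(1,2)[OF that(2)[unfolded 2 eq normal_forms_eq_odd_cochain]]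
        by auto
    next
      case 3
      then show ?thesis
        using equivalent_odd_cochain_invariants(1,2)[OF that(2)[unfolded 3 eq normal_forms_eq_odd_cochain]]
        by auto
    next
      case (4 l)
      \<comment> \<open>For \<open>d_lam m l\<close> the factor between b and (c2, -c1) is l m! /
        (m+1)!, that is \<open>l / of_nat (m + 1)\<close>.\<close>
      have "fact (m + 1) = of_nat (m + 1) * (fact m :: 'k)" by (simp add: fact_Suc)
      then have "l * fact m = l / of_nat (m + 1) * fact (m + 1)" by simp
      then have "b1 = l / of_nat (m + 1) * c2 \<and> b2 = - (l / of_nat (m + 1) * c1)"
        using equivalent_odd_cochain_invariants(3)[OF that(2)[unfolded 4 eq normal_forms_eq_odd_cochain],
            of "l / of_nat (m + 1)"] by simp
      then show ?thesis
        using 4 equivalent_odd_cochain_invariants(1,2)[OF that(2)[unfolded 4 eq normal_forms_eq_odd_cochain]]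
        by auto
    qed
  qed
  show ?thesis
  proof (cases "a1 = 0 \<and> a2 = 0 \<and> \<not> (c1 = 0 \<and> c2 = 0)")
    case True
    then have a0: "a1 = 0 \<and> a2 = 0" and c0: "\<not> (c1 = 0 \<and> c2 = 0)" by blast+
    obtain l l' where "e = d_lam m l" "e' = d_lam m l'"
      and "b1 = l / of_nat (m + 1) * c2" "b2 = - (l / of_nat (m + 1) * c1)"
      and "b1 = l' / of_nat (m + 1) * c2" "b2 = - (l' / of_nat (m + 1) * c1)"
      using inv[OF e] inv[OF e'] unfolding if_P[OF a0] if_not_P[OF c0] by blast
    \<comment> \<open>As c is nonzero, b is a multiple of (c2, -c1) with only one possible
      factor.\<close>
    moreover from this have "l / of_nat (m + 1) = l' / of_nat (m + 1)"
      using c0 by (metis mult_cancel_right neg_equal_iff_equal)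
    then have "l = l'" by (simp del: of_nat_Suc of_nat_add)
    ultimately show ?thesis by simp
  next
    case False
    then show ?thesis using inv[OF e] inv[OF e'] by metis
  qed
qed

text \<open>Existence and uniqueness give the classification. All inequivalences follow by applying
  uniqueness to a normal form in place of d, which reduces them to inequality of
  coordinates.\<close>

theorem mainTheorem2:
  fixes m :: nat
  shows "(\<forall>e \<in> normal_forms m :: ('k::{alg_closed_field, field_char_0} S \<Rightarrow> 'k W) set.
            codifferential e \<and> e \<in> L (m + 2) \<and> e \<noteq> (\<lambda>_. 0))
    \<and> (\<forall>d :: 'k S \<Rightarrow> 'k W. codifferential d \<and> d \<in> L (m + 2) \<and> d \<noteq> (\<lambda>_. 0) \<longrightarrow>
            (\<exists>!e. e \<in> normal_forms m \<and> equivalent d e))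
    \<and> \<not> equivalent (d_inf m :: 'k S \<Rightarrow> 'k W) (d_star m)
    \<and> \<not> equivalent (d_inf m :: 'k S \<Rightarrow> 'k W) (d_sharp m)
    \<and> \<not> equivalent (d_star m :: 'k S \<Rightarrow> 'k W) (d_sharp m)
    \<and> (\<forall>l :: 'k. \<not> equivalent (d_lam m l) (d_inf m)
            \<and> \<not> equivalent (d_lam m l) (d_star m)
            \<and> \<not> equivalent (d_lam m l) (d_sharp m))
    \<and> (\<forall>l l' :: 'k. equivalent (d_lam m l) (d_lam m l') \<longleftrightarrow> l = l')"
proof -
  have nz: "fact k \<noteq> (0 :: 'k)" for k by simp
  have nf: "codifferential e \<and> e \<in> L (m + 2) \<and> e \<noteq> (\<lambda>_. 0)"
    if "e \<in> normal_forms m" for e :: "'k S \<Rightarrow> 'k W"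
  proof -
    from that consider "e = d_inf m" | "e = d_star m" | "e = d_sharp m" | l where "e = d_lam m l"
      by (auto simp: normal_forms_def)
    then show ?thesis
    proof cases
      case 3
      have fact_Suc': "fact (m + 1) = of_nat (m + 1) * (fact m :: 'k)" by simp
      \<comment> \<open>The one quadratic relation not trivially satisfied by
        \<open>d_sharp\<close>; it holds precisely because of the coefficient -(m+2).\<close>
      have "of_nat (m + 2) * fact (m + 1) * fact (m + 2) =
          - (of_nat (m + 1) * fact (m + 2) * - (of_nat (m + 2) * (fact m :: 'k)))"
        unfolding fact_Suc' by (simp only: mult_minus_right minus_minus mult_ac)
      then show ?thesis
        unfolding 3 normal_forms_eq_odd_cochain codifferential_odd_cochain_iff odd_cochain_eq_0_iff
        using nz odd_cochain_in_L by (simp del: fact_Suc of_nat_Suc of_nat_add)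
    qed (use nz odd_cochain_in_L in \<open>simp_all add: normal_forms_eq_odd_cochain odd_cochain_eq_0_iff
          codifferential_odd_cochain_iff del: fact_Suc of_nat_Suc of_nat_add\<close>)
  qed
  have refl: "equivalent e e" if "e \<in> normal_forms m" for e :: "'k S \<Rightarrow> 'k W"
  proof -
    from that nf obtain a1 a2 b1 b2 c1 c2 where "e = odd_cochain m (a1, a2) (b1, b2) (c1, c2)"
      by (metis codifferential_def odd_element_eq_odd_cochain)
    then show ?thesis by (auto intro: equivalent_odd_cochainI[of 1 1 0 0])
  qed
  \<comment> \<open>Each normal form is equivalent to itself, so a second one equivalent to it must
    coincide with it.\<close>
  have eq_iff: "equivalent e e' \<longleftrightarrow> e = e'" if "e \<in> normal_forms m" "e' \<in> normal_forms m"
    for e e' :: "'k S \<Rightarrow> 'k W"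
    using that refl nf normal_form_unique[of e m e e'] by (auto simp: codifferential_def)
  have mem: "d_inf m \<in> normal_forms m" "d_star m \<in> normal_forms m" "d_sharp m \<in> normal_forms m"
    "d_lam m l \<in> normal_forms m" for l :: 'k
    by (simp_all add: normal_forms_def)
  have distinct: "d_inf m \<noteq> (d_star m :: 'k S \<Rightarrow> 'k W)"
    "d_inf m \<noteq> (d_sharp m :: 'k S \<Rightarrow> 'k W)" "d_star m \<noteq> (d_sharp m :: 'k S \<Rightarrow> 'k W)"
    "d_lam m l \<noteq> d_inf m" "d_lam m l \<noteq> d_star m" "d_lam m l \<noteq> d_sharp m"
    "d_lam m l = d_lam m l' \<longleftrightarrow> l = l'" for l l' :: 'k
    by (simp_all add: normal_forms_eq_odd_cochain odd_cochain_eq_iff nz del: fact_Suc)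
  have "\<exists>!e. e \<in> normal_forms m \<and> equivalent d e"
    if "codifferential d" "d \<in> L (m + 2)" "d \<noteq> (\<lambda>_. 0)" for d :: "'k S \<Rightarrow> 'k W"
    using codifferential_equivalent_to_normal_form[OF that] normal_form_unique[of d m] that
    by (auto simp: codifferential_def)
  then show ?thesis
    using nf by (simp add: eq_iff mem distinct)
qed

end
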